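(* Let $f:(\mathbb{R}^n\setminus\mathcal{C})\times U\to\mathbb{R}^n$ be continuous. If the control system $\dot x=f(x,u)$, $u\in U$, is sample stabilizable to $\mathcal{C}$, then it is GAC to $\mathcal{C}$.
   Context: Standing setting. $\mathcal{C}\subset\mathbb{R}^n$ is a nonempty closed set with compact boundary, $U\subseteq\mathbb{R}^m$ is a closed cone, and $\mathbf d(x):=\mathrm{dist}(x,\mathcal{C})$ is the Euclidean distance from $\mathcal{C}$. $\mathcal{KL}$ functions (descent rates): continuous $\beta:[0,+\infty)^2\to[0,+\infty)$ such that $\beta(0,t)=0$ and $\beta(\cdot,t)$ is strictly increasing and unbounded for each $t\ge0$; $\beta(r,\cdot)$ is strictly decreasing for each $r>0$; $\beta(r,t)\to0$ as $t\to+\infty$ for each $r\ge0$. Admissible pair for $(f,U)$: a pair $(x,u)$ for which there is $T_x\in(0,+\infty]$ such that $u\in L^\infty_{loc}([0,T_x),U)$ (essentially bounded on compact subsets), $x:[0,T_x)\to\mathbb{R}^n\setminus\mathcal{C}$ is locally absolutely continuous, $\dot x(t)=f(x(t),u(t))$ for a.e. $t\in[0,T_x)$, and, if $T_x<+\infty$, $\lim_{t\to T_x^-}\mathbf d(x(t))=0$. If $T_x<+\infty$, $x$ is extended to $[0,+\infty)$ by setting $x(t):=\bar z$ for $t\ge T_x$, where $\bar z\in\partial\mathcal{C}$ is an arbitrary point of the form $\bar z=\lim_i x(\tau_i)$ for some $\tau_i\uparrow T_x$. GAC. The system is globally asymptotically controllable (GAC) to $\mathcal{C}$ if there is $\beta\in\mathcal{KL}$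 such that for every $z\in\mathbb{R}^n\setminus\mathcal{C}$ there is an admissible pair $(x,u)$ for $(f,U)$ with $x(0)=z$ and $\mathbf d(x(t))\le\beta(\mathbf d(z),t)$ for all $t\ge0$. Sample stabilizability. A partition is a sequence $\pi=(t_k)_{k\ge0}$ with $t_0=0$, $t_{k-1}<t_k$, $t_k\to+\infty$; $\mathrm{diam}(\pi):=\sup_{k\ge1}(t_k-t_{k-1})$. Given a locally bounded feedback $K:\mathbb{R}^n\setminus\mathcal{C}\to U$, a partition $\pi$ and $z\in\mathbb{R}^n\setminus\mathcal{C}$, a $\pi$-sampling trajectory-control pair from $z$ is a pair $(x,u)$ where $x$ is continuous with $x(0)=z$ and is obtained by recursively solving $\dot x(t)=f(x(t),K(x(t_{k-1})))$ for a.e. $t\in[t_{k-1},t_k]$ (with $x(t)\in\mathbb{R}^n\setminus\mathcal{C}$) from $t_{k-1}$ up to $\tau_k:=\max\{t_{k-1},\sup\{\tau\in[t_{k-1},t_k]: x\text{ is defined on }[t_{k-1},\tau)\}\}$; $x$ is defined on $[0,T^-)$ with $T^-:=\inf\{\tau_k:\tau_k<t_k\}$ ($+\infty$ if there is no such $k$), and $u(t):=K(x(t_{k-1}))$ for $t\in[t_{k-1},t_k)\cap[0,T^-)$. If $T^-<+\infty$ and $\lim_{t\to T^-}\mathbf d(x(t))=0$, then $T_x:=T^-$ and $x$ is extended to $[0,+\infty)$ as in the definition of admissible pair. $K$ sample stabilizes $\dot x=f(x,u)$ to $\mathcal{C}$ if there is $\beta\in\mathcal{KL}$ such that for each $0<r<R$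 there is $\delta=\delta(R,r)>0$ such that, for every partition $\pi$ with $\mathrm{diam}(\pi)\le\delta$ and every $z\in\mathbb{R}^n\setminus\mathcal{C}$ with $\mathbf d(z)\le R$, any $\pi$-sampling trajectory-control pair $(x,u)$ with $x(0)=z$ is admissible for $(f,U)$ and satisfies $\mathbf d(x(t))\le\max\{\beta(\mathbf d(z),t),r\}$ for all $t\ge0$. The system is sample stabilizable to $\mathcal{C}$ if such a $K$ exists. *)

theory Defs
  imports "HOL-Analysis.Analysis"
begin

text \<open>
  Throughout, \<open>C\<close> is the target, \<open>U\<close> the control set and \<open>infdist x C\<close> the distance from the
  target. Trajectories and controls are total functions on \<open>real\<close> which, unless extended
  explicitly, are meaningful only on \<open>time_dom T\<close> = [0,T), where 0 < T \<le> \<infinity>.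
\<close>

definition time_dom :: "ereal \<Rightarrow> real set" where
  "time_dom T = {t. 0 \<le> t \<and> ereal t < T}"

definition KL :: "(real \<Rightarrow> real \<Rightarrow> real) \<Rightarrow> bool" where
  "KL \<beta> \<longleftrightarrow>
     continuous_on ({0..} \<times> {0..}) (\<lambda>(r, t). \<beta> r t) \<and>
     (\<forall>r\<ge>0. \<forall>t\<ge>0. 0 \<le> \<beta> r t) \<and>
     (\<forall>t\<ge>0. \<beta> 0 t = 0 \<and> strict_mono_on {0..} (\<lambda>r. \<beta> r t) \<and>
            \<not> bdd_above ((\<lambda>r. \<beta> r t) ` {0..})) \<and>
     (\<forall>r>0. strict_antimono_on {0..} (\<beta> r)) \<and>
     (\<forall>r\<ge>0. (\<beta> r \<longlongrightarrow> 0) at_top)"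

subsection \<open>Caratheodory solutions and admissible pairs\<close>

text \<open>A division of a set \<open>S \<subseteq> {a..b}\<close> is exactly a finite family of nonoverlapping compact
  subintervals of \<open>{a..b}\<close>.\<close>

definition abs_continuous_on_Icc ::
  "real \<Rightarrow> real \<Rightarrow> (real \<Rightarrow> 'a::real_normed_vector) \<Rightarrow> bool" where
  "abs_continuous_on_Icc a b x \<longleftrightarrow>
     (\<forall>\<epsilon>>0. \<exists>\<delta>>0. \<forall>D S. D division_of S \<and> S \<subseteq> {a..b} \<and> (\<Sum>J\<in>D. Sup J - Inf J) < \<delta> \<longrightarrow>
        (\<Sum>J\<in>D. norm (x (Sup J) - x (Inf J))) < \<epsilon>)"

definition loc_abs_continuous :: "ereal \<Rightarrow> (real \<Rightarrow> 'a::real_normed_vector) \<Rightarrow> bool" where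
  "loc_abs_continuous T x \<longleftrightarrow> (\<forall>a b. {a..b} \<subseteq> time_dom T \<longrightarrow> abs_continuous_on_Icc a b x)"

definition Linf_loc :: "ereal \<Rightarrow> 'b::euclidean_space set \<Rightarrow> (real \<Rightarrow> 'b) \<Rightarrow> bool" where
  "Linf_loc T U u \<longleftrightarrow>
     set_borel_measurable lebesgue (time_dom T) u \<and>
     (\<forall>t\<in>time_dom T. u t \<in> U) \<and>
     (\<forall>J. compact J \<and> J \<subseteq> time_dom T \<longrightarrow>
        (\<exists>B. AE t in lebesgue. t \<in> J \<longrightarrow> norm (u t) \<le> B))"

definition reaches_target :: "'a::euclidean_space set \<Rightarrow> ereal \<Rightarrow> (real \<Rightarrow> 'a) \<Rightarrow> bool" where
  "reaches_target C T x \<longleftrightarrow>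
     T < \<infinity> \<and> ((\<lambda>t. infdist (x t) C) \<longlongrightarrow> 0) (at_left (real_of_ereal T))"

text \<open>The values of \<open>x\<close> from time \<open>T\<close> on are a constant point of \<open>frontier C\<close> that is a cluster
  point of \<open>x\<close> at \<open>T\<close>.\<close>

definition extended_by_limit :: "'a::euclidean_space set \<Rightarrow> ereal \<Rightarrow> (real \<Rightarrow> 'a) \<Rightarrow> bool" where
  "extended_by_limit C T x \<longleftrightarrow>
     (\<exists>z\<in>frontier C.
        (\<exists>\<tau>::nat \<Rightarrow> real. strict_mono \<tau> \<and> (\<forall>i. \<tau> i \<in> time_dom T) \<and>
            (\<lambda>i. ereal (\<tau> i)) \<longlonglongrightarrow> T \<and> (\<lambda>i. x (\<tau> i)) \<longlonglongrightarrow> z) \<and>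
        (\<forall>t. T \<le> ereal t \<longrightarrow> x t = z))"

definition admissible_pair ::
  "('a::euclidean_space \<Rightarrow> 'b::euclidean_space \<Rightarrow> 'a) \<Rightarrow> 'a set \<Rightarrow> 'b set \<Rightarrow>
   ereal \<Rightarrow> (real \<Rightarrow> 'a) \<Rightarrow> (real \<Rightarrow> 'b) \<Rightarrow> bool" where
  "admissible_pair f C U T x u \<longleftrightarrow>
     0 < T \<and>
     Linf_loc T U u \<and>
     (\<forall>t\<in>time_dom T. x t \<notin> C) \<and>
     loc_abs_continuous T x \<and>
     (AE t in lebesgue. t \<in> time_dom T \<longrightarrow> (x has_vector_derivative f (x t) (u t)) (at t)) \<and>
     (T < \<infinity> \<longrightarrow> reaches_target C T x \<and> extended_by_limit C T x)"

definition GAC ::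
  "('a::euclidean_space \<Rightarrow> 'b::euclidean_space \<Rightarrow> 'a) \<Rightarrow> 'a set \<Rightarrow> 'b set \<Rightarrow> bool" where
  "GAC f C U \<longleftrightarrow>
     (\<exists>\<beta>. KL \<beta> \<and>
        (\<forall>z. z \<notin> C \<longrightarrow>
           (\<exists>T x u. admissible_pair f C U T x u \<and> x 0 = z \<and>
              (\<forall>t\<ge>0. infdist (x t) C \<le> \<beta> (infdist z C) t))))"

subsection \<open>Sampling trajectories and sample stabilizability\<close>

definition time_partition :: "(nat \<Rightarrow> real) \<Rightarrow> bool" where
  "time_partition \<pi> \<longleftrightarrow> \<pi> 0 = 0 \<and> (\<forall>k. \<pi> k < \<pi> (Suc k)) \<and> filterlim \<pi> at_top sequentially"

definition partition_diam :: "(nat \<Rightarrow> real) \<Rightarrow> ereal" where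
  "partition_diam \<pi> = (SUP k. ereal (\<pi> (Suc k) - \<pi> k))"

definition feedback :: "'a::euclidean_space set \<Rightarrow> 'b::euclidean_space set \<Rightarrow> ('a \<Rightarrow> 'b) \<Rightarrow> bool" where
  "feedback C U K \<longleftrightarrow>
     (\<forall>z. z \<notin> C \<longrightarrow> K z \<in> U) \<and>
     (\<forall>z. z \<notin> C \<longrightarrow> (\<exists>e>0. bounded (K ` (ball z e - C))))"

text \<open>With the trajectory defined on \<open>[0,T)\<close>, \<open>step_end \<pi> T k\<close> is the time up to which the
  solution of the step on \<open>[\<pi> k, \<pi> (Suc k)]\<close> is defined, and \<open>sampling_end \<pi> T\<close> is the resulting
  end of the sampling procedure (the infimum of the empty set being \<open>\<infinity>\<close>). The steps are
  numbered from 0.\<close>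

definition step_end :: "(nat \<Rightarrow> real) \<Rightarrow> ereal \<Rightarrow> nat \<Rightarrow> real" where
  "step_end \<pi> T k =
     max (\<pi> k) (Sup {s \<in> {\<pi> k..\<pi> (Suc k)}. {\<pi> k..<s} \<subseteq> time_dom T})"

definition sampling_end :: "(nat \<Rightarrow> real) \<Rightarrow> ereal \<Rightarrow> ereal" where
  "sampling_end \<pi> T = (INF k\<in>{k. step_end \<pi> T k < \<pi> (Suc k)}. ereal (step_end \<pi> T k))"

definition sampling_arc ::
  "('a::euclidean_space \<Rightarrow> 'b::euclidean_space \<Rightarrow> 'a) \<Rightarrow> 'a set \<Rightarrow> ('a \<Rightarrow> 'b) \<Rightarrow>
   (nat \<Rightarrow> real) \<Rightarrow> ereal \<Rightarrow> (real \<Rightarrow> 'a) \<Rightarrow> bool" where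
  "sampling_arc f C K \<pi> T x \<longleftrightarrow>
     continuous_on (time_dom T) x \<and>
     loc_abs_continuous T x \<and>
     (\<forall>t\<in>time_dom T. x t \<notin> C) \<and>
     (\<forall>k. AE t in lebesgue. t \<in> {\<pi> k..\<pi> (Suc k)} \<inter> time_dom T \<longrightarrow>
        (x has_vector_derivative f (x t) (K (x (\<pi> k)))) (at t))"

text \<open>The recursive solution is continued as long as possible: \<open>x\<close> is not the proper restriction
  of another arc. Without this requirement every truncation of a trajectory, which stops
  away from the target, would count as a sampling trajectory.\<close>

definition sampling_pair ::
  "('a::euclidean_space \<Rightarrow> 'b::euclidean_space \<Rightarrow> 'a) \<Rightarrow> 'a set \<Rightarrow> ('a \<Rightarrow> 'b) \<Rightarrow>
   (nat \<Rightarrow> real) \<Rightarrow> ereal \<Rightarrow> (real \<Rightarrow> 'a) \<Rightarrow> (real \<Rightarrow> 'b) \<Rightarrow> bool" where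
  "sampling_pair f C K \<pi> T x u \<longleftrightarrow>
     0 < T \<and>
     sampling_arc f C K \<pi> T x \<and>
     \<not> (\<exists>T' y. T < T' \<and> sampling_arc f C K \<pi> T' y \<and> (\<forall>t\<in>time_dom T. y t = x t)) \<and>
     T = sampling_end \<pi> T \<and>
     (\<forall>k. \<forall>t\<in>{\<pi> k..<\<pi> (Suc k)} \<inter> time_dom T. u t = K (x (\<pi> k))) \<and>
     (reaches_target C T x \<longrightarrow> extended_by_limit C T x)"

definition sample_stabilizes ::
  "('a::euclidean_space \<Rightarrow> 'b::euclidean_space \<Rightarrow> 'a) \<Rightarrow> 'a set \<Rightarrow> 'b set \<Rightarrow> ('a \<Rightarrow> 'b) \<Rightarrow> bool" where
  "sample_stabilizes f C U K \<longleftrightarrow>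
     (\<exists>\<beta>. KL \<beta> \<and>
        (\<forall>r R. 0 < r \<and> r < R \<longrightarrow>
           (\<exists>\<delta>>0. \<forall>\<pi> z. time_partition \<pi> \<and> partition_diam \<pi> \<le> ereal \<delta> \<and>
                         z \<notin> C \<and> infdist z C \<le> R \<longrightarrow>
              (\<forall>T x u. sampling_pair f C K \<pi> T x u \<and> x 0 = z \<longrightarrow>
                 admissible_pair f C U T x u \<and>
                 (\<forall>t\<ge>0. infdist (x t) C \<le> max (\<beta> (infdist z C) t) r)))))"

definition sample_stabilizable ::
  "('a::euclidean_space \<Rightarrow> 'b::euclidean_space \<Rightarrow> 'a) \<Rightarrow> 'a set \<Rightarrow> 'b set \<Rightarrow> bool" where
  "sample_stabilizable f C U \<longleftrightarrow> (\<exists>K. feedback C U K \<and> sample_stabilizes f C U K)"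

text \<open>The equation \<open>T = sampling_end \<pi> T\<close> in \<open>sampling_pair\<close> is no restriction.\<close>

lemma step_end_eq:
  assumes \<pi>: "time_partition \<pi>" and T: "0 < T"
  shows "ereal (step_end \<pi> T k) = max (ereal (\<pi> k)) (min T (ereal (\<pi> (Suc k))))"
proof -
  have mono: "strict_mono \<pi>"
    using \<pi> by (simp add: time_partition_def strict_mono_Suc_iff)
  have nn: "0 \<le> \<pi> k"
    using \<pi> mono strict_mono_leD[OF mono, of 0 k] by (simp add: time_partition_def)
  have lt: "\<pi> k < \<pi> (Suc k)"
    using \<pi> by (simp add: time_partition_def)
  let ?A = "{s \<in> {\<pi> k..\<pi> (Suc k)}. {\<pi> k..<s} \<subseteq> time_dom T}"
  have sub: "{\<pi> k..<s} \<subseteq> time_dom T \<longleftrightarrow> s \<le> \<pi> k \<or> ereal s \<le> T" for s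
  proof
    assume a: "{\<pi> k..<s} \<subseteq> time_dom T"
    show "s \<le> \<pi> k \<or> ereal s \<le> T"
    proof (rule ccontr)
      assume "\<not> (s \<le> \<pi> k \<or> ereal s \<le> T)"
      then have 1: "\<pi> k < s" "T < ereal s" by auto
      obtain r where r: "T = ereal r" using T 1 by (cases T) auto
      have "max r (\<pi> k) \<in> {\<pi> k..<s}" using 1 r by auto
      then have "max r (\<pi> k) \<in> time_dom T" using a by blast
      then show False using r by (auto simp: time_dom_def)
    qed
  next
    assume "s \<le> \<pi> k \<or> ereal s \<le> T"
    then show "{\<pi> k..<s} \<subseteq> time_dom T"
    proof
      assume s: "ereal s \<le> T"
      have "ereal t < T" if "t < s" for t
        using less_le_trans[OF _ s, of "ereal t"] that by simp
      then show ?thesis using nn by (auto simp: time_dom_def)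
    qed auto
  qed
  show ?thesis
  proof (cases "T \<le> ereal (\<pi> k)")
    case True
    then have "?A = {\<pi> k}"
    proof -
      have "s \<le> \<pi> k" if "ereal s \<le> T" for s
        using order_trans[OF that True] by simp
      then have "(s \<le> \<pi> k \<or> ereal s \<le> T) = (s \<le> \<pi> k)" for s
        by blast
      then have "?A = {s \<in> {\<pi> k..\<pi> (Suc k)}. s \<le> \<pi> k}"
        unfolding sub by simp
      also have "\<dots> = {\<pi> k}"
        using lt by auto
      finally show ?thesis .
    qed
    moreover have "T \<le> ereal (\<pi> (Suc k))"
      using True lt by (meson ereal_less_eq(3) less_imp_le order_trans)
    ultimately show ?thesis
      using True by (simp add: step_end_def min_def max_def)
  next
    case False
    obtain m where m: "min T (ereal (\<pi> (Suc k))) = ereal m"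
    proof (cases T)
      case (real r)
      then show ?thesis
        using that[of "min r (\<pi> (Suc k))"] by (simp add: min_def)
    qed (use T that in auto)
    have km: "\<pi> k \<le> m"
    proof -
      have "ereal (\<pi> k) \<le> min T (ereal (\<pi> (Suc k)))"
        using False lt by (intro min.boundedI) auto
      then show ?thesis unfolding m by simp
    qed
    have "?A = {\<pi> k..m}"
    proof -
      have "s \<le> m \<longleftrightarrow> ereal s \<le> T \<and> s \<le> \<pi> (Suc k)" for s
      proof -
        have "s \<le> m \<longleftrightarrow> ereal s \<le> min T (ereal (\<pi> (Suc k)))"
          unfolding m by simp
        then show ?thesis by simp
      qed
      then have "{\<pi> k..m} = {s. \<pi> k \<le> s \<and> ereal s \<le> T \<and> s \<le> \<pi> (Suc k)}"
        by (simp add: atLeastAtMost_def atLeast_def atMost_def Int_def)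
      moreover have "ereal s \<le> T" if "s \<le> \<pi> k" for s
        using False that by (meson ereal_less_eq(3) linear order_trans)
      ultimately show ?thesis unfolding sub by auto
    qed
    then show ?thesis
      using km m by (simp add: step_end_def max_def)
  qed
qed

lemma sampling_end_eq:
  assumes \<pi>: "time_partition \<pi>" and T: "0 < T"
  shows "sampling_end \<pi> T = T"
proof (rule antisym)
  have lt: "\<pi> k < \<pi> (Suc k)" for k
    using \<pi> by (simp add: time_partition_def)
  have se: "ereal (step_end \<pi> T k) = max (ereal (\<pi> k)) (min T (ereal (\<pi> (Suc k))))" for k
    by (rule step_end_eq[OF \<pi> T])
  show "T \<le> sampling_end \<pi> T"
    unfolding sampling_end_def
  proof (rule INF_greatest)
    fix k assume "k \<in> {k. step_end \<pi> T k < \<pi> (Suc k)}"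
    then have "ereal (step_end \<pi> T k) < ereal (\<pi> (Suc k))" by simp
    then show "T \<le> ereal (step_end \<pi> T k)"
      unfolding se by (auto simp: max_def min_def split: if_splits)
  qed
  show "sampling_end \<pi> T \<le> T"
  proof (cases T)
    case (real t)
    have "\<exists>k. t < \<pi> k"
      using \<pi> unfolding time_partition_def filterlim_at_top_dense eventually_sequentially by blast
    then obtain k where k: "t < \<pi> k" "\<And>j. j < k \<Longrightarrow> \<not> t < \<pi> j"
      using exists_least_iff[of "\<lambda>k. t < \<pi> k"] by blast
    have "k \<noteq> 0"
    proof
      assume "k = 0"
      then show False using k(1) \<pi> T real by (simp add: time_partition_def)
    qed
    then obtain j where j: "k = Suc j" by (cases k) auto
    have "\<pi> j \<le> t" using k(2)[of j] j by auto
    then have "ereal (step_end \<pi> T j) = T"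
      unfolding se using k(1) j real by (simp add: max_def min_def)
    moreover have "step_end \<pi> T j < \<pi> (Suc j)"
      using calculation k(1) j real by simp
    ultimately show ?thesis
      using INF_lower[of j "{k. step_end \<pi> T k < \<pi> (Suc k)}" "\<lambda>k. ereal (step_end \<pi> T k)"]
      by (simp add: sampling_end_def)
  qed (use T in auto)
qed

end

theory Submission
  imports Defs "HOL-Complex_Analysis.Great_Picard"
begin

text \<open>
  From a point at distance at most \<open>R\<close>, a sampling trajectory with a fine enough partition never
  exceeds \<open>\<beta> R 0 + R\<close> and has distance at most \<open>R / 2\<close> after a time depending only on \<open>R\<close>.
  Concatenating such pieces along the dyadic levels \<open>2\<^sup>j, 2\<^sup>j\<^sup>-\<^sup>1, \<dots>\<close> (each lasting at least one
  unit of time, or until the target is reached) gives admissible pairs with uniform overshoot and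
  uniform attraction, and these two properties yield a \<open>KL\<close> bound. Sampling
  trajectories exist because Peano's theorem gives a first arc and Zorn's lemma a maximal one; what
  happens at the end of the maximal arc is controlled by the stabilization hypothesis itself.
\<close>

section \<open>Bounds of class KL\<close>

text \<open>For given radii \<open>r < R\<close>, sampling with a fine partition brings the distance
  only below \<open>r\<close>, and the required mesh depends on \<open>r\<close>. No single sampled
  trajectory is therefore known to converge. GAC asks only for an open-loop control, so the sampling
  may be restarted with a new partition whenever the bound on the distance has been halved. The
  levels form one grid indexed by the integers, independent of the starting point. One family of
  stage times then serves all starting points, and a finite sum of them bounds the time that any
  start within distance \<open>N\<close> needs to descend to a given level. Rounding the starting
  distance up to the grid costs at most a factor 2. The stabilization hypothesis speaks about all
  sampling pairs and says nothing until one exists; that is where continuity of \<open>f\<close>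
  enters.\<close>

definition ramp :: "(nat \<Rightarrow> real) \<Rightarrow> nat \<Rightarrow> real \<Rightarrow> real" where
  "ramp Q k t = max 0 (min 1 (1 + Q k - t)) / (real k + 1)"

lemma ramp_nonneg: "0 \<le> ramp Q k t"
  and ramp_le: "ramp Q k t \<le> 1 / (real k + 1)"
  by (auto simp: ramp_def intro!: divide_right_mono)

lemma ramp_le_1: "ramp Q k t \<le> 1"
  using ramp_le[of Q k t] by (rule order_trans) simp

lemma ramp_eq: "t \<le> Q k \<Longrightarrow> ramp Q k t = 1 / (real k + 1)"
  by (simp add: ramp_def)

lemma ramp_antimono: "s \<le> t \<Longrightarrow> ramp Q k t \<le> ramp Q k s"
  unfolding ramp_def by (intro divide_right_mono max.mono min.mono) auto

text \<open>The descending part has slope \<open>1 / (k + 1)\<close>, so the constant 1 serves all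
  \<open>k\<close> at once; a common Lipschitz constant survives the supremum over
  \<open>k\<close>.\<close>

lemma ramp_lipschitz: "ramp Q k s \<le> ramp Q k t + \<bar>s - t\<bar>"
proof -
  have "max 0 (min 1 (1 + Q k - s)) \<le> max 0 (min 1 (1 + Q k - t)) + \<bar>s - t\<bar>"
    by (auto simp: max_def min_def)
  then have "ramp Q k s \<le> (max 0 (min 1 (1 + Q k - t)) + \<bar>s - t\<bar>) / (real k + 1)"
    unfolding ramp_def by (rule divide_right_mono) simp
  also have "\<dots> = ramp Q k t + \<bar>s - t\<bar> / (real k + 1)"
    by (simp add: ramp_def add_divide_distrib)
  also have "\<bar>s - t\<bar> / (real k + 1) \<le> \<bar>s - t\<bar>"
    by (simp add: divide_le_eq mult_le_cancel_left1)
  finally show ?thesis by simp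
qed

lemma bdd_above_ramp: "bdd_above (range (\<lambda>k. ramp Q k t))"
  using ramp_le_1 by (intro bdd_aboveI[of _ 1]) auto

lemma ramp_le_SUP: "ramp Q k t \<le> (SUP k. ramp Q k t)"
  by (intro cSUP_upper bdd_above_ramp) simp

text \<open>\<open>ramp Q k\<close> is a plateau of height \<open>1 / (k + 1)\<close> up to time
  \<open>Q k\<close>, followed by a linear descent to zero within one unit of time. The supremum is
  thus at least \<open>1 / (k + 1)\<close> until \<open>Q k\<close>, whatever the order of the times
  \<open>Q k\<close>, and \<open>exp (- t)\<close> supplies the positivity and the strict decrease
  that plateaus lack.\<close>

definition decay_env :: "(nat \<Rightarrow> real) \<Rightarrow> real \<Rightarrow> real" where
  "decay_env Q t = exp (- t) + (SUP k. ramp Q k t)"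

lemma ramp_le_decay_env: "ramp Q k t \<le> decay_env Q t"
  using ramp_le_SUP[of Q k t] by (simp add: decay_env_def add_increasing)

lemma decay_env_pos: "0 < decay_env Q t"
  using ramp_le_SUP[of Q 0 t] ramp_nonneg[of Q 0 t]
  by (simp add: decay_env_def add_pos_nonneg)

lemma decay_env_strict: "s < t \<Longrightarrow> decay_env Q t < decay_env Q s"
  unfolding decay_env_def
  by (intro add_less_le_mono cSUP_mono bdd_above_ramp) (auto intro!: exI ramp_antimono)

lemma continuous_on_decay_env: "continuous_on A (decay_env Q)"
proof -
  have le: "(SUP k. ramp Q k s) \<le> (SUP k. ramp Q k t) + \<bar>s - t\<bar>" for s t
  proof (rule cSUP_least)
    fix k show "ramp Q k s \<le> (SUP k. ramp Q k t) + \<bar>s - t\<bar>"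
      using ramp_lipschitz[of Q k s t] ramp_le_SUP[of Q k t] by linarith
  qed simp
  have "1-lipschitz_on A (\<lambda>t. SUP k. ramp Q k t)"
  proof (rule lipschitz_onI)
    fix s t show "dist (SUP k. ramp Q k s) (SUP k. ramp Q k t) \<le> 1 * dist s t"
      using le[of s t] le[of t s] by (simp add: dist_real_def)
  qed simp
  then show ?thesis
    unfolding decay_env_def[abs_def] by (intro continuous_intros lipschitz_on_continuous_on)
qed

lemma decay_env_tendsto: "(decay_env Q \<longlongrightarrow> 0) at_top"
proof -
  have "((\<lambda>t. SUP k. ramp Q k t) \<longlongrightarrow> 0) at_top"
  proof (rule tendstoI)
    fix e :: real assume e: "0 < e"
    \<comment> \<open>Ramps of index at least \<open>n\<close> stay below \<open>e / 2\<close>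
      everywhere; each of the finitely many others vanishes after \<open>1 + Q k\<close>.\<close>
    obtain n where n: "1 / (real n + 1) < e / 2"
      using e half_gt_zero nat_approx_posE[of "e/2"] by (metis of_nat_Suc add.commute)
    have "\<forall>\<^sub>F t in at_top. \<forall>k\<in>{..<n}. ramp Q k t \<le> e / 2"
    proof (rule eventually_ball_finite)
      show "\<forall>k\<in>{..<n}. \<forall>\<^sub>F t in at_top. ramp Q k t \<le> e / 2"
      proof
        fix k show "\<forall>\<^sub>F t in at_top. ramp Q k t \<le> e / 2"
          using eventually_ge_at_top[of "1 + Q k"] by eventually_elim (use e in \<open>simp add: ramp_def\<close>)
      qed
    qed simp
    then show "\<forall>\<^sub>F t in at_top. dist (SUP k. ramp Q k t) 0 < e"
    proof eventually_elim
      case (elim t)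
      have "ramp Q k t \<le> e / 2" for k
      proof (cases "k < n")
        case False
        then have "1 / (real k + 1) \<le> 1 / (real n + 1)" by (intro divide_left_mono) auto
        then show ?thesis using ramp_le[of Q k t] n by linarith
      qed (use elim in auto)
      then have "(SUP k. ramp Q k t) \<le> e / 2" by (intro cSUP_least) auto
      moreover have "0 \<le> (SUP k. ramp Q k t)"
        using ramp_le_SUP[of Q 0 t] ramp_nonneg[of Q 0 t] by linarith
      ultimately show ?case using e by (simp add: dist_real_def)
    qed
  qed
  moreover have "((\<lambda>t::real. exp (- t)) \<longlongrightarrow> 0) at_top"
    using filterlim_compose[OF exp_at_bot filterlim_uminus_at_bot_at_top] by (simp add: o_def)
  ultimately show ?thesis
    unfolding decay_env_def[abs_def] using tendsto_add by fastforce
qed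

text \<open>The inequality \<open>r \<le> a r\<close> serves twice: it makes \<open>a\<close>
  positive away from zero, and it makes \<open>a r * b t\<close> unbounded in \<open>r\<close> for
  each fixed \<open>t\<close>.\<close>

lemma KL_mult:
  assumes cont: "continuous_on {0..} a" and mono: "strict_mono_on {0..} a" and "a 0 = 0"
    and unb: "\<And>r. 0 \<le> r \<Longrightarrow> r \<le> a r"
    and bcont: "continuous_on {0..} b" and bpos: "\<And>t. 0 \<le> t \<Longrightarrow> 0 < b t"
    and banti: "strict_antimono_on {0..} b" and lim: "(b \<longlongrightarrow> 0) at_top"
  shows "KL (\<lambda>r t. a r * b t)"
proof -
  have apos: "0 < a r" if "0 < r" for r using unb[of r] that by linarith
  have "continuous_on ({0..} \<times> {0..}) (\<lambda>x. a (fst x) * b (snd x))"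
    by (intro continuous_intros continuous_on_compose2[OF cont] continuous_on_compose2[OF bcont]) auto
  moreover have "\<not> bdd_above ((\<lambda>r. a r * b t) ` {0..})" if t: "0 \<le> t" for t
  proof
    assume "bdd_above ((\<lambda>r. a r * b t) ` {0..})"
    then obtain B where B: "\<And>r. 0 \<le> r \<Longrightarrow> a r * b t \<le> B" by (auto simp: bdd_above_def)
    define r where "r = (\<bar>B\<bar> + 1) / b t"
    have r: "0 \<le> r" using bpos[OF t] by (simp add: r_def)
    have "\<bar>B\<bar> + 1 = r * b t" using bpos[OF t] by (simp add: r_def)
    also have "\<dots> \<le> a r * b t" using unb[OF r] bpos[OF t] by simp
    finally show False using B[OF r] by linarith
  qed
  moreover have "strict_mono_on {0..} (\<lambda>r. a r * b t)" if "0 \<le> t" for t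
    using bpos[OF that] mono by (auto simp: monotone_on_def)
  moreover have "strict_antimono_on {0..} (\<lambda>t. a r * b t)" if "0 < r" for r
    using apos[OF that] banti by (auto simp: monotone_on_def)
  moreover have "0 \<le> a r * b t" if "0 \<le> r" "0 \<le> t" for r t
    using unb[of r] bpos[of t] that by (simp add: mult_nonneg_nonneg)
  moreover have "((\<lambda>t. a r * b t) \<longlongrightarrow> 0) at_top" for r
    using tendsto_mult_left[OF lim, of "a r"] by simp
  ultimately show ?thesis
    using \<open>a 0 = 0\<close> unfolding KL_def by (auto simp: case_prod_beta)
qed

text \<open>
  The \<open>KL\<close> function is a product \<open>a(r) b(t)\<close>. Since \<open>h = sqrt h * sqrt h\<close>, one factor bounded by
  \<open>sqrt (M r)\<close> provides the vanishing at \<open>r = 0\<close>, so \<open>b\<close> only has to dominate the other up to a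
  factor depending on \<open>r\<close>.
\<close>

lemma KL_bound:
  fixes h :: "'z \<Rightarrow> real \<Rightarrow> real"
  assumes M: "continuous_on {0..} M" "mono_on {0..} M" "M 0 = 0"
    and h: "\<And>z t. z \<in> A \<Longrightarrow> 0 \<le> t \<Longrightarrow> 0 \<le> h z t \<and> h z t \<le> M (\<rho> z)"
    and \<rho>: "\<And>z. z \<in> A \<Longrightarrow> 0 \<le> \<rho> z"
    and attr: "\<And>N e. 0 < e \<Longrightarrow> \<exists>S. \<forall>z\<in>A. \<rho> z \<le> N \<longrightarrow> (\<forall>t\<ge>S. 0 \<le> t \<longrightarrow> h z t \<le> e)"
  shows "\<exists>\<beta>. KL \<beta> \<and> (\<forall>z\<in>A. \<forall>t\<ge>0. h z t \<le> \<beta> (\<rho> z) t)"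
proof -
  \<comment> \<open>The tolerance is a square because \<open>sqrt (h z t)\<close>, and not
    \<open>h z t\<close>, is compared with the envelope.\<close>
  have "\<exists>S. \<forall>z\<in>A. \<rho> z \<le> real k \<longrightarrow> (\<forall>t\<ge>S. 0 \<le> t \<longrightarrow> h z t \<le> (1 / (real k + 1))\<^sup>2)" for k
    by (rule attr) simp
  then obtain P where P: "\<And>k z t. z \<in> A \<Longrightarrow> \<rho> z \<le> real k \<Longrightarrow> P k \<le> t \<Longrightarrow> 0 \<le> t \<Longrightarrow>
      h z t \<le> (1 / (real k + 1))\<^sup>2"
    by metis
  \<comment> \<open>The times \<open>P k\<close> need not be unbounded. The maximum with
    \<open>real k\<close> ensures that every time is exceeded by some \<open>Q k\<close>, so that
    the least such index exists.\<close>
  define Q where "Q k = max (P k) (real k)" for k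
  \<comment> \<open>The summand \<open>r\<close> makes \<open>a\<close> strictly increasing and at
    least \<open>r\<close>, even where \<open>M\<close> is constant. The terms \<open>2\<close> and
    \<open>(r + 2) * sqrt (M r)\<close> come from the two cases in the proof of
    \<open>key\<close>.\<close>
  define a where "a r = (sqrt (M r) + r) * (2 + (r + 2) * sqrt (M r))" for r
  have M0: "0 \<le> M r" if "0 \<le> r" for r
    using M(2,3) that by (metis atLeast_iff monotone_onD order_refl)
  have sqrtM: "mono_on {0..} (\<lambda>r. sqrt (M r))"
    using M(2) by (auto simp: monotone_on_def)
  let ?b = "decay_env Q"
  have "KL (\<lambda>r t. a r * ?b t)"
  proof (rule KL_mult)
    show "continuous_on {0..} a"
      unfolding a_def by (intro continuous_intros M)
    show "strict_mono_on {0..} a"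
    proof (rule monotone_onI)
      fix r s :: real assume rs: "r \<in> {0..}" "s \<in> {0..}" "r < s"
      have "sqrt (M r) \<le> sqrt (M s)" "0 \<le> sqrt (M r)"
        using monotone_onD[OF sqrtM, of r s] M0[of r] rs by auto
      moreover from this have "(r + 2) * sqrt (M r) \<le> (s + 2) * sqrt (M s)"
        using rs by (intro mult_mono) auto
      ultimately show "a r < a s"
        unfolding a_def using rs by (intro mult_less_le_imp_less add_le_less_mono)
            (auto intro!: add_pos_nonneg)
    qed
    show "r \<le> a r" if "0 \<le> r" for r
    proof -
      have "r * 1 \<le> (sqrt (M r) + r) * (2 + (r + 2) * sqrt (M r))"
        using that M0[OF that] by (intro mult_mono) auto
      then show ?thesis by (simp add: a_def)
    qed
    show "strict_antimono_on {0..} ?b"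
      by (auto simp: monotone_on_def intro: decay_env_strict)
  qed (auto simp: a_def M continuous_on_decay_env decay_env_pos decay_env_tendsto)
  moreover have "h z t \<le> a (\<rho> z) * ?b t" if z: "z \<in> A" and t: "0 \<le> t" for z t
  proof -
    define r where "r = \<rho> z"
    have r: "0 \<le> r" using \<rho>[OF z] by (simp add: r_def)
    have hM: "sqrt (h z t) \<le> sqrt (M r)" and h0: "0 \<le> h z t"
      using h[OF z t] by (auto simp: r_def)
    have b: "0 < ?b t" by (rule decay_env_pos)
    have key: "sqrt (h z t) \<le> (2 + (r + 2) * sqrt (M r)) * ?b t"
    proof -
      obtain k0 where k0: "t < real k0" using reals_Archimedean2 by blast
      \<comment> \<open>Minimality brackets \<open>t\<close>: the plateau of index \<open>k\<close>
        still keeps the envelope above \<open>1 / (k + 1)\<close>, while for positive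
        \<open>k\<close> the time \<open>Q (k - 1)\<close> has passed, so that attraction at index
        \<open>k - 1\<close> is available if \<open>r \<le> k - 1\<close>.\<close>
      define k where "k = (LEAST k. t < Q k)"
      have k: "t < Q k" unfolding k_def by (rule LeastI[of _ k0]) (use k0 in \<open>auto simp: Q_def\<close>)
      have kb: "1 / (real k + 1) \<le> ?b t"
        using ramp_le_decay_env[of Q k t] ramp_eq[of t Q k] k by simp
      show ?thesis
      proof (cases "real k < r + 1")
        \<comment> \<open>Here \<open>k + 1 < r + 2\<close>, so the envelope is at least
          \<open>1 / (r + 2)\<close> and the overshoot bound alone suffices.\<close>
        case True
        have "1 \<le> (real k + 1) * ?b t" using kb by (simp add: divide_le_eq mult.commute)
        also have "\<dots> \<le> (r + 2) * ?b t" using True b by (intro mult_right_mono) auto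
        finally have "sqrt (M r) * 1 \<le> sqrt (M r) * ((r + 2) * ?b t)"
          using M0[OF r] by (intro mult_left_mono) auto
        then have "sqrt (h z t) \<le> 2 * ?b t + sqrt (M r) * ((r + 2) * ?b t)"
          using hM b by linarith
        then show ?thesis by (simp add: algebra_simps)
      next
        case False
        then have "k \<noteq> 0" using r by (cases k) auto
        then obtain j where j: "k = Suc j" by (cases k) auto
        have "\<not> t < Q j"
          using not_less_Least[of j "\<lambda>k. t < Q k"] j by (simp add: k_def)
        then have "P j \<le> t" by (simp add: Q_def)
        moreover have "\<rho> z \<le> real j" using False j by (simp add: r_def)
        ultimately have "h z t \<le> (1 / (real j + 1))\<^sup>2" using P[OF z _ _ t] by blast
        then have "sqrt (h z t) \<le> sqrt ((1 / (real j + 1))\<^sup>2)" by (rule real_sqrt_le_mono)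
        also have "\<dots> = 1 / (real j + 1)" by simp
        \<comment> \<open>Since \<open>k = j + 1\<close> is at least 1, the quotient
          \<open>(k + 1) / k\<close> is at most 2.\<close>
        also have "\<dots> \<le> 2 * (1 / (real k + 1))" using j by (simp add: field_simps)
        also have "\<dots> \<le> 2 * ?b t" using kb by simp
        also have "\<dots> \<le> (2 + (r + 2) * sqrt (M r)) * ?b t"
          using b M0[OF r] r by (intro mult_right_mono) auto
        finally show ?thesis .
      qed
    qed
    have "h z t = sqrt (h z t) * sqrt (h z t)" using h0 by simp
    also have "\<dots> \<le> (sqrt (M r) + r) * ((2 + (r + 2) * sqrt (M r)) * ?b t)"
      using hM r h0 M0[OF r] by (intro mult_mono key) (simp_all add: add_increasing2)
    also have "\<dots> = a (\<rho> z) * ?b t" by (simp add: a_def r_def mult.assoc)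
    finally show ?thesis .
  qed
  ultimately show ?thesis by blast
qed

lemma KL_props:
  assumes "KL \<beta>"
  shows "\<And>r t. 0 \<le> r \<Longrightarrow> 0 \<le> t \<Longrightarrow> 0 \<le> \<beta> r t"
    and "\<And>t. 0 \<le> t \<Longrightarrow> \<beta> 0 t = 0"
    and "\<And>r s t. 0 \<le> r \<Longrightarrow> r \<le> s \<Longrightarrow> 0 \<le> t \<Longrightarrow> \<beta> r t \<le> \<beta> s t"
    and "\<And>r s t. 0 \<le> r \<Longrightarrow> 0 \<le> s \<Longrightarrow> s \<le> t \<Longrightarrow> \<beta> r t \<le> \<beta> r s"
    and "\<And>r. 0 \<le> r \<Longrightarrow> (\<beta> r \<longlongrightarrow> 0) at_top"
    and "continuous_on {0..} (\<lambda>r. \<beta> r 0)"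
proof -
  show "0 \<le> \<beta> r t" if "0 \<le> r" "0 \<le> t" for r t using assms that by (simp add: KL_def)
  show zero: "\<beta> 0 t = 0" if "0 \<le> t" for t using assms that by (simp add: KL_def)
  show "\<beta> r t \<le> \<beta> s t" if "0 \<le> r" "r \<le> s" "0 \<le> t" for r s t
  proof -
    have "strict_mono_on {0..} (\<lambda>r. \<beta> r t)" using assms that by (simp add: KL_def)
    from monotone_onD[OF this, of r s] show ?thesis using that by (cases "r = s") auto
  qed
  show "\<beta> r t \<le> \<beta> r s" if "0 \<le> r" "0 \<le> s" "s \<le> t" for r s t
  proof (cases "r = 0 \<or> s = t")
    case False
    then have "strict_antimono_on {0..} (\<beta> r)" using assms that by (simp add: KL_def)
    from monotone_onD[OF this, of s t] show ?thesis using that False by auto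
  qed (use that zero in auto)
  show "(\<beta> r \<longlongrightarrow> 0) at_top" if "0 \<le> r" for r using assms that by (simp add: KL_def)
  have "continuous_on ({0..} \<times> {0..}) (\<lambda>(r, t). \<beta> r t)" using assms by (simp add: KL_def)
  moreover have "continuous_on {0..} (\<lambda>r::real. (r, 0::real))" by (intro continuous_intros)
  ultimately have "continuous_on {0..} (\<lambda>r::real. case (r, 0::real) of (r, t) \<Rightarrow> \<beta> r t)"
    by (rule continuous_on_compose2) auto
  then show "continuous_on {0..} (\<lambda>r. \<beta> r 0)" by simp
qed

section \<open>Peano's existence theorem\<close>

text \<open>Tonelli's delayed equation. The \<open>n\<close>-th Picard iterate is already stationary on \<open>[0, n h]\<close>.\<close>

lemma delayed_solution_exists:
  fixes g :: "'a::euclidean_space \<Rightarrow> 'a" and h :: real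
  assumes g: "continuous_on UNIV g" and h: "0 < h"
  obtains y :: "real \<Rightarrow> 'a" where "continuous_on UNIV y"
    "\<And>t. t \<in> {0..1} \<Longrightarrow> y t = z + integral {0..max 0 (t - h)} (\<lambda>s. g (y s))"
proof -
  define F where "F y t = z + integral {0..max 0 (t - h)} (\<lambda>s. g (y s))" for y :: "real \<Rightarrow> 'a" and t
  define Y where "Y n = (F ^^ n) (\<lambda>_. z)" for n
  have Y_Suc: "Y (Suc n) = F (Y n)" for n by (simp add: Y_def)
  have contF: "continuous_on UNIV (F y)" if y: "continuous_on UNIV y" for y
  proof -
    have gy: "continuous_on {0..b} (\<lambda>s. g (y s))" for b
      by (rule continuous_on_compose2[OF g continuous_on_subset[OF y]]) auto
    \<comment> \<open>The indefinite integral is handled on one bounded interval at a time.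
      Continuity is therefore shown on each \<open>{..b}\<close> and glued over the open half-lines
      \<open>{..<b}\<close>.\<close>
    have "continuous_on {..b} (F y)" for b
      unfolding F_def
      by (intro continuous_intros continuous_on_compose2
            [OF indefinite_integral_continuous_1[OF integrable_continuous_real[OF gy[of "max 0 (b - h)"]]]])
        auto
    then have "continuous_on {..<b} (F y)" for b
      by (rule continuous_on_subset[of "{..b}"]) auto
    then have "continuous_on (\<Union>b. {..<b}) (F y)"
      by (intro continuous_on_open_UN) auto
    moreover have "(\<Union>b. {..<b}) = (UNIV :: real set)"
      by (auto intro: lt_ex gt_ex)
    ultimately show ?thesis by simp
  qed
  have contY: "continuous_on UNIV (Y n)" for n
    by (induction n) (auto simp: Y_def intro: contF)
  \<comment> \<open>For \<open>t \<le> (n + 1) * h\<close> the delayed integral sees only times up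
    to \<open>n * h\<close>, where the two preceding iterates already agree.\<close>
  have stat: "Y (Suc n) t = Y n t" if "t \<le> real n * h" for n t
    using that
  proof (induction n arbitrary: t)
    case 0
    then show ?case using h by (simp add: Y_def F_def)
  next
    case (Suc n)
    have "Y (Suc n) s = Y n s" if "s \<in> {0..max 0 (t - h)}" for s
    proof (rule Suc.IH)
      show "s \<le> real n * h" using that Suc.prems h by (auto simp: algebra_simps max_def split: if_splits)
    qed
    then have "integral {0..max 0 (t - h)} (\<lambda>s. g (Y (Suc n) s)) = integral {0..max 0 (t - h)} (\<lambda>s. g (Y n s))"
      by (intro integral_cong) simp
    then have "F (Y (Suc n)) t = F (Y n) t" unfolding F_def by simp
    then show ?case unfolding Y_Suc[symmetric] .
  qed
  obtain n where n: "1 < real n * h" using h reals_Archimedean3 by blast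
  show thesis
  proof
    show "continuous_on UNIV (Y n)" by (rule contY)
    show "Y n t = z + integral {0..max 0 (t - h)} (\<lambda>s. g (Y n s))" if "t \<in> {0..1}" for t
      using stat[of t n] n that by (simp add: Y_Suc F_def)
  qed
qed

text \<open>Delayed solutions are \<open>B\<close>-Lipschitz whatever the delay, so Arzela-Ascoli
  yields a uniform limit as the delay \<open>1 / (n + 1)\<close> shrinks. Dominated convergence
  passes to the limit under the integral, and the stretch cut off by the delay contributes at most
  \<open>B / (n + 1)\<close>.\<close>

lemma peano_bounded:
  fixes g :: "'a::euclidean_space \<Rightarrow> 'a"
  assumes g: "continuous_on UNIV g" and B: "\<And>x. norm (g x) \<le> B"
  obtains y :: "real \<Rightarrow> 'a" where "continuous_on {0..1} y"
    "\<And>t. t \<in> {0..1} \<Longrightarrow> y t = z + integral {0..t} (\<lambda>s. g (y s))"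
proof -
  have "\<exists>y. continuous_on UNIV y \<and>
    (\<forall>t\<in>{0..1}. y t = z + integral {0..max 0 (t - 1 / real (Suc n))} (\<lambda>s. g (y s)))" for n
    by (rule delayed_solution_exists[OF g, of "1 / real (Suc n)" z]) auto
  then obtain y where cont: "\<And>n. continuous_on UNIV (y n)"
    and y: "\<And>n t. t \<in> {0..1} \<Longrightarrow> y n t = z + integral {0..max 0 (t - 1 / real (Suc n))} (\<lambda>s. g (y n s))"
    by metis
  have B0: "0 \<le> B" using B norm_ge_zero order_trans by blast
  have int: "(\<lambda>s. g (y n s)) integrable_on {a..b}" for n a b
    by (intro integrable_continuous_real continuous_on_compose2[OF g] continuous_on_subset[OF cont]) auto
  have bound: "norm (integral {a..b} (\<lambda>s. g (y n s))) \<le> B * (b - a)" if "a \<le> b" for n a b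
    using that by (intro integral_bound B continuous_on_compose2[OF g] continuous_on_subset[OF cont]) auto
  have diff: "norm (integral {0..a} (\<lambda>s. g (y n s)) - integral {0..b} (\<lambda>s. g (y n s))) \<le> B * \<bar>a - b\<bar>"
    if "0 \<le> a" "0 \<le> b" for n a b
  proof -
    have *: "norm (integral {0..b} (\<lambda>s. g (y n s)) - integral {0..a} (\<lambda>s. g (y n s))) \<le> B * (b - a)"
      if "0 \<le> a" "a \<le> b" for a b
      using Henstock_Kurzweil_Integration.integral_combine[OF that int, of n] bound[OF that(2), of n]
      by (simp add: algebra_simps) (metis add_diff_cancel_left')
    show ?thesis using *[of a b] *[of b a] that by (cases "a \<le> b") (auto simp: norm_minus_commute)
  qed
  have lip: "norm (y n s - y n t) \<le> B * \<bar>s - t\<bar>" if "s \<in> {0..1}" "t \<in> {0..1}" for n s t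
  proof -
    have "norm (y n s - y n t) \<le> B * \<bar>max 0 (s - 1 / real (Suc n)) - max 0 (t - 1 / real (Suc n))\<bar>"
      using diff[of "max 0 (s - 1 / real (Suc n))" "max 0 (t - 1 / real (Suc n))" n]
      unfolding y[OF that(1)] y[OF that(2)] by simp
    also have "\<dots> \<le> B * \<bar>s - t\<bar>" using B0 by (intro mult_left_mono) auto
    finally show ?thesis .
  qed
  have bdd: "norm (y n t) \<le> norm z + B" if "t \<in> {0..1}" for n t
  proof -
    have "y n 0 = z" by (subst y) auto
    then have "norm (y n t - z) \<le> B * \<bar>t - 0\<bar>" using lip[of t 0 n] that by simp
    also have "\<dots> \<le> B" using B0 that by (simp add: mult_left_le)
    finally show ?thesis using norm_triangle_sub[of "y n t" z] by linarith
  qed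
  have equi: "\<exists>d>0. \<forall>n t. t \<in> {0..1} \<and> norm (s - t) < d \<longrightarrow> norm (y n s - y n t) < e"
    \<comment> \<open>The constant is \<open>B + 1\<close> rather than \<open>B\<close> because
      \<open>B\<close> may be zero.\<close>
    if s: "s \<in> {0..1}" and e: "0 < e" for s e
  proof (intro exI[of _ "e / (B + 1)"] conjI allI impI)
    show "0 < e / (B + 1)" using B0 e by simp
    fix n t assume t: "t \<in> {0..1} \<and> norm (s - t) < e / (B + 1)"
    then have "norm (y n s - y n t) \<le> B * \<bar>s - t\<bar>" using lip[OF s] by blast
    also have "\<dots> \<le> (B + 1) * \<bar>s - t\<bar>" by (simp add: mult_right_mono)
    also have "\<dots> < e" using t B0 by (simp add: field_simps)
    finally show "norm (y n s - y n t) < e" .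
  qed
  obtain w k where w: "continuous_on {0..1} w" and k: "strict_mono (k :: nat \<Rightarrow> nat)"
    and lim: "\<And>e. 0 < e \<Longrightarrow> \<exists>N. \<forall>n x. N \<le> n \<and> x \<in> {0..1} \<longrightarrow> norm (y (k n) x - w x) < e"
    by (rule Arzela_Ascoli[of "{0..1::real}" y "norm z + B", OF compact_Icc bdd equi]) blast+
  have pw: "(\<lambda>n. y (k n) s) \<longlonglongrightarrow> w s" if "s \<in> {0..1}" for s
    unfolding LIMSEQ_iff using lim that by blast
  show thesis
  proof (rule that)
    show "continuous_on {0..1} w" by (rule w)
    fix t :: real assume t: "t \<in> {0..1}"
    have gw: "(\<lambda>n. g (y (k n) s)) \<longlonglongrightarrow> g (w s)" if "s \<in> {0..t}" for s
    proof -
      have "isCont g (w s)" using g by (simp add: continuous_on_eq_continuous_at)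
      then show ?thesis by (rule isCont_tendsto_compose) (use pw that t in auto)
    qed
    have "(\<lambda>n. integral {0..t} (\<lambda>s. g (y (k n) s))) \<longlonglongrightarrow> integral {0..t} (\<lambda>s. g (w s))"
    proof (rule dominated_convergence(2)[where h = "\<lambda>_. B"])
      show "(\<lambda>s. g (y (k n) s)) integrable_on {0..t}" for n by (rule int)
    qed (use B gw in auto)
    moreover have "(\<lambda>n. y (k n) t - z - integral {0..t} (\<lambda>s. g (y (k n) s))) \<longlonglongrightarrow> 0"
    proof (rule Lim_null_comparison)
      have "norm (y n t - z - integral {0..t} (\<lambda>s. g (y n s))) \<le> B * (1 / real (Suc n))" for n
      proof -
        have "norm (y n t - z - integral {0..t} (\<lambda>s. g (y n s))) \<le> B * \<bar>max 0 (t - 1 / real (Suc n)) - t\<bar>"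
          using diff[of "max 0 (t - 1 / real (Suc n))" t n] t by (subst y[OF t]) simp
        also have "\<dots> \<le> B * (1 / real (Suc n))" using B0 t by (intro mult_left_mono) (auto simp: max_def)
        finally show ?thesis .
      qed
      then show "\<forall>\<^sub>F n in sequentially. norm (y (k n) t - z - integral {0..t} (\<lambda>s. g (y (k n) s)))
          \<le> B * (1 / real (Suc (k n)))" by simp
      have "(\<lambda>n. 1 / real (Suc n)) \<longlonglongrightarrow> 0" using LIMSEQ_inverse_real_of_nat by (simp add: inverse_eq_divide)
      from LIMSEQ_subseq_LIMSEQ[OF this k] show "(\<lambda>n. B * (1 / real (Suc (k n)))) \<longlonglongrightarrow> 0"
        by (intro tendsto_mult_right_zero) (simp add: o_def)
    qed
    ultimately have "(\<lambda>n. (y (k n) t - z - integral {0..t} (\<lambda>s. g (y (k n) s)))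
        + (z + integral {0..t} (\<lambda>s. g (y (k n) s)))) \<longlonglongrightarrow> 0 + (z + integral {0..t} (\<lambda>s. g (w s)))"
      by (intro tendsto_add tendsto_const)
    then have "(\<lambda>n. y (k n) t) \<longlonglongrightarrow> z + integral {0..t} (\<lambda>s. g (w s))" by simp
    then show "w t = z + integral {0..t} (\<lambda>s. g (w s))"
      using LIMSEQ_unique pw[OF t] by blast
  qed
qed

text \<open>The field is made global and bounded by composing it with the projection onto a closed ball.\<close>

lemma peano_local:
  fixes g :: "'a::euclidean_space \<Rightarrow> 'a"
  assumes "open S" and g: "continuous_on S g" and z: "z \<in> S"
  obtains T B :: real and y where "0 < T" "B-lipschitz_on {0..T} y" "y 0 = z" "y ` {0..T} \<subseteq> S"
    "\<And>t. t \<in> {0<..<T} \<Longrightarrow> (y has_vector_derivative g (y t)) (at t)"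
proof -
  obtain e where e: "0 < e" "cball z e \<subseteq> S" using \<open>open S\<close> z open_contains_cball by blast
  define p where "p = closest_point (cball z e)"
  have ne: "cball z e \<noteq> {}" using e(1) by auto
  have pin: "p x \<in> cball z e" for x
    unfolding p_def using closest_point_in_set[OF closed_cball ne] .
  have "continuous_on UNIV p"
    unfolding p_def using continuous_on_closest_point[OF convex_cball closed_cball ne] .
  then have gp: "continuous_on UNIV (\<lambda>x. g (p x))"
    using pin e(2) by (intro continuous_on_compose2[OF g]) auto
  have "compact (g ` cball z e)"
    using continuous_on_subset[OF g e(2)] by (intro compact_continuous_image) auto
  then have "\<exists>B. \<forall>x\<in>cball z e. norm (g x) \<le> B"
    using compact_imp_bounded[of "g ` cball z e"] by (simp add: bounded_iff)
  then obtain B where B: "\<And>x. x \<in> cball z e \<Longrightarrow> norm (g x) \<le> B" by blast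
  have B0: "0 \<le> B" using order_trans[OF norm_ge_zero B[of z]] e by simp
  obtain y :: "real \<Rightarrow> 'a" where y: "continuous_on {0..1} y"
    "\<And>t. t \<in> {0..1} \<Longrightarrow> y t = z + integral {0..t} (\<lambda>s. g (p (y s)))"
    using peano_bounded[OF gp B[OF pin], of z] by blast
  \<comment> \<open>At speed at most \<open>B\<close> the curve cannot leave
    \<open>cball z e\<close> before time \<open>e / (B + 1)\<close>, and inside the ball the
    projection is the identity.\<close>
  define T where "T = min 1 (e / (B + 1))"
  have T: "0 < T" "T \<le> 1" "B * T \<le> e"
  proof -
    show "0 < T" "T \<le> 1" using e(1) B0 by (auto simp: T_def)
    have "B * T \<le> (B + 1) * (e / (B + 1))"
      using B0 e(1) by (intro mult_mono) (auto simp: T_def)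
    then show "B * T \<le> e" using B0 by simp
  qed
  have cont: "continuous_on {0..1} (\<lambda>s. g (p (y s)))"
    by (rule continuous_on_compose2[OF gp y(1)]) auto
  have y0: "y 0 = z" by (subst y(2)) auto
  have der: "(y has_vector_derivative g (p (y t))) (at t within {0..1})" if "t \<in> {0..1}" for t
  proof -
    have "((\<lambda>t. z + integral {0..t} (\<lambda>s. g (p (y s)))) has_vector_derivative g (p (y t))) (at t within {0..1})"
      using integral_has_vector_derivative[OF cont that] by (auto intro!: derivative_eq_intros)
    then show ?thesis
      by (rule has_vector_derivative_transform[OF that, rotated]) (use y(2) in auto)
  qed
  have lip1: "B-lipschitz_on {0..1} y"
  proof (rule bounded_derivative_imp_lipschitz)
    show "(y has_derivative (\<lambda>s. s *\<^sub>R g (p (y t)))) (at t within {0..1})" if "t \<in> {0..1}" for t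
      using der[OF that] by (simp add: has_vector_derivative_def)
    show "onorm (\<lambda>s. s *\<^sub>R g (p (y t))) \<le> B" for t
      using B[OF pin] B0 by (intro onorm_bound) (simp_all add: mult.commute[of B] mult_left_mono)
  qed (use B0 in auto)
  have ball: "y t \<in> cball z e" if "t \<in> {0..T}" for t
  proof -
    have "dist (y 0) (y t) \<le> B * dist 0 t"
      using lipschitz_onD[OF lip1, of 0 t] that T by auto
    also have "\<dots> \<le> B * T" using that B0 by (intro mult_left_mono) auto
    finally show ?thesis using T(3) y0 by simp
  qed
  show thesis
  proof
    show "B-lipschitz_on {0..T} y" by (rule lipschitz_on_subset[OF lip1]) (use T in auto)
    show "y ` {0..T} \<subseteq> S" using ball e(2) by blast
    fix t assume t: "t \<in> {0<..<T}"
    have "(y has_vector_derivative g (p (y t))) (at t)"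
      using der[of t] t T at_within_interior[of t "{0..1}"] by simp
    moreover have "p (y t) = y t"
      unfolding p_def using ball[of t] t by (intro closest_point_self) auto
    ultimately show "(y has_vector_derivative g (y t)) (at t)" by simp
  qed (use T y0 in auto)
qed

section \<open>Absolutely continuous arcs and concatenation\<close>

lemma AE_lebesgue_neq: "AE t::real in lebesgue. t \<noteq> c"
  unfolding eventually_ae_filter_negligible by (intro exI[of _ "{c}"]) auto

lemma AE_lebesgue_shift:
  fixes P :: "real \<Rightarrow> bool"
  assumes "AE t in lebesgue. P t" shows "AE t in lebesgue. P (t - s)"
proof -
  obtain N where N: "negligible N" "{t. \<not> P t} \<subseteq> N"
    using assms by (auto simp: eventually_ae_filter_negligible)
  have "{t. \<not> P (t - s)} \<subseteq> (+) s ` N"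
  proof
    fix t assume "t \<in> {t. \<not> P (t - s)}"
    then have "t - s \<in> N" using N(2) by auto
    then show "t \<in> (+) s ` N" by (intro image_eqI[of _ _ "t - s"]) auto
  qed
  then show ?thesis
    using negligible_translation[OF N(1)] by (auto simp: eventually_ae_filter_negligible)
qed

lemma time_dom_shift: "0 < T \<Longrightarrow> s \<le> t \<Longrightarrow> 0 \<le> s \<Longrightarrow> t \<in> time_dom (ereal s + T) \<longleftrightarrow> t - s \<in> time_dom T"
  by (cases T) (auto simp: time_dom_def)

text \<open>Rational endpoints \<open>b\<close> suffice, which leaves countably many exceptional
  sets. The intervals omit the null set consisting of \<open>0\<close>, where a two-sided derivative
  would depend on values at negative times.\<close>

lemma AE_time_dom:
  assumes "\<And>b. ereal b < T \<Longrightarrow> AE t in lebesgue. t \<in> {0<..<b} \<longrightarrow> P t"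
  shows "AE t in lebesgue. t \<in> time_dom T \<longrightarrow> P t"
proof -
  have "AE t in lebesgue. \<forall>b\<in>{b \<in> \<rat>. ereal b < T}. t \<in> {0<..<b} \<longrightarrow> P t"
    by (subst AE_ball_countable) (use assms countable_rat in \<open>auto intro: countable_subset\<close>)
  with AE_lebesgue_neq[of 0] show ?thesis
  proof eventually_elim
    case (elim t)
    show ?case
    proof
      assume "t \<in> time_dom T"
      then have t: "0 < t" "ereal t < T" using elim by (auto simp: time_dom_def)
      obtain b where "t < real_of_rat b" "ereal (real_of_rat b) < T"
        using ereal_dense3[OF t(2)] by auto
      then show "P t" using elim t by auto
    qed
  qed
qed

section \<open>Absolute continuity through divisions of intervals\<close>

lemma division_Icc_cases:
  fixes S :: "real set"
  assumes "D division_of S" "S \<subseteq> {a..b}" "J \<in> D"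
  obtains c d where "J = {c..d}" "a \<le> c" "c \<le> d" "d \<le> b"
proof -
  obtain c d where J: "J = cbox c d" using division_ofD(4)[OF assms(1,3)] by blast
  have ne: "J \<noteq> {}" using division_ofD(3)[OF assms(1,3)] .
  have "J \<subseteq> {a..b}" using division_ofD(2)[OF assms(1,3)] assms(2) by blast
  with J ne that[of c d] show thesis by auto
qed

lemma abs_continuous_on_IccE:
  assumes "abs_continuous_on_Icc a b x" "0 < e"
  obtains d where "0 < d"
    "\<And>D S. D division_of S \<Longrightarrow> S \<subseteq> {a..b} \<Longrightarrow> (\<Sum>J\<in>D. Sup J - Inf J) < d \<Longrightarrow>
      (\<Sum>J\<in>D. norm (x (Sup J) - x (Inf J))) < e"
proof -
  obtain d where "0 < d" and d: "\<forall>D S. D division_of S \<and> S \<subseteq> {a..b} \<and> (\<Sum>J\<in>D. Sup J - Inf J) < d \<longrightarrow>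
      (\<Sum>J\<in>D. norm (x (Sup J) - x (Inf J))) < e"
    using assms(1)[unfolded abs_continuous_on_Icc_def, rule_format, OF assms(2)] by (elim exE conjE)
  show thesis by (rule that[OF \<open>0 < d\<close>]) (rule d[rule_format], intro conjI)
qed

lemma abs_continuous_on_Icc_empty: "b < a \<Longrightarrow> abs_continuous_on_Icc a b x"
  unfolding abs_continuous_on_Icc_def by (auto intro!: exI[of _ 1])

lemma abs_continuous_on_Icc_cong:
  assumes "abs_continuous_on_Icc a b x" "\<And>t. t \<in> {a..b} \<Longrightarrow> x t = y t"
  shows "abs_continuous_on_Icc a b y"
proof -
  have eq: "(\<Sum>J\<in>D. norm (y (Sup J) - y (Inf J))) = (\<Sum>J\<in>D. norm (x (Sup J) - x (Inf J)))"
    if D: "D division_of S" "S \<subseteq> {a..b}" for D S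
  proof (rule sum.cong[OF refl])
    fix J assume "J \<in> D"
    then obtain c d where "J = {c..d}" "a \<le> c" "c \<le> d" "d \<le> b"
      using division_Icc_cases[OF D] by blast
    then show "norm (y (Sup J) - y (Inf J)) = norm (x (Sup J) - x (Inf J))"
      using assms(2) by simp
  qed
  show ?thesis
    unfolding abs_continuous_on_Icc_def
  proof (intro allI impI)
    fix e :: real assume "0 < e"
    then obtain d where "0 < d"
      "\<And>D S. D division_of S \<Longrightarrow> S \<subseteq> {a..b} \<Longrightarrow> (\<Sum>J\<in>D. Sup J - Inf J) < d \<Longrightarrow>
        (\<Sum>J\<in>D. norm (x (Sup J) - x (Inf J))) < e"
      using abs_continuous_on_IccE[OF assms(1)] by blast
    then show "\<exists>\<delta>>0. \<forall>D S. D division_of S \<and> S \<subseteq> {a..b} \<and> (\<Sum>J\<in>D. Sup J - Inf J) < \<delta> \<longrightarrow>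
        (\<Sum>J\<in>D. norm (y (Sup J) - y (Inf J))) < e"
      using eq by (intro exI[of _ d]) auto
  qed
qed

lemma abs_continuous_on_Icc_lipschitz:
  assumes "L-lipschitz_on {a..b} x"
  shows "abs_continuous_on_Icc a b x"
  unfolding abs_continuous_on_Icc_def
proof (intro allI impI)
  fix e :: real assume e: "0 < e"
  have L: "0 \<le> L" using assms lipschitz_on_nonneg by blast
  show "\<exists>\<delta>>0. \<forall>D S. D division_of S \<and> S \<subseteq> {a..b} \<and> (\<Sum>J\<in>D. Sup J - Inf J) < \<delta> \<longrightarrow>
        (\<Sum>J\<in>D. norm (x (Sup J) - x (Inf J))) < e"
  proof (intro exI[of _ "e / (L + 1)"] conjI allI impI)
    show "0 < e / (L + 1)" using e L by simp
    fix D S assume D: "D division_of S \<and> S \<subseteq> {a..b} \<and> (\<Sum>J\<in>D. Sup J - Inf J) < e / (L + 1)"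
    have "(\<Sum>J\<in>D. norm (x (Sup J) - x (Inf J))) \<le> (\<Sum>J\<in>D. (L + 1) * (Sup J - Inf J))"
    proof (rule sum_mono)
      fix J assume "J \<in> D"
      then obtain c d where J: "J = {c..d}" "a \<le> c" "c \<le> d" "d \<le> b"
        using D division_Icc_cases by metis
      have "norm (x d - x c) \<le> L * \<bar>d - c\<bar>"
        using lipschitz_onD[OF assms, of d c] J by (simp add: dist_norm)
      also have "\<dots> \<le> (L + 1) * (d - c)" using J by (simp add: mult_right_mono)
      finally show "norm (x (Sup J) - x (Inf J)) \<le> (L + 1) * (Sup J - Inf J)" using J by simp
    qed
    also have "\<dots> = (L + 1) * (\<Sum>J\<in>D. Sup J - Inf J)" by (simp add: sum_distrib_left)
    also have "\<dots> < e" using D L by (simp add: field_simps)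
    finally show "(\<Sum>J\<in>D. norm (x (Sup J) - x (Inf J))) < e" .
  qed
qed

text \<open>Different cells have disjoint interiors, so nonempty traces on \<open>{u..v}\<close> can
  coincide only in a single point. The image set merges such traces, and a functional with
  \<open>G {c} = 0\<close> does not notice.\<close>

lemma division_clip:
  fixes S :: "real set"
  assumes D: "D division_of S" "S \<subseteq> {a..b}" and uv: "u \<le> v"
  defines "E \<equiv> (\<lambda>J. J \<inter> {u..v}) ` {J \<in> D. J \<inter> {u..v} \<noteq> {}}"
  shows "E division_of (S \<inter> {u..v})"
    and "\<And>G :: real set \<Rightarrow> real. (\<And>c. G {c} = 0) \<Longrightarrow>
      sum G E = (\<Sum>J\<in>D. if J \<inter> {u..v} \<noteq> {} then G (J \<inter> {u..v}) else 0)"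
proof -
  have fin: "finite D" using D(1) by (rule division_ofD)
  have "{u..v} \<noteq> {}" using uv by simp
  then have "{{u..v}} division_of {u..v}" using division_of_self[of u v] by simp
  from division_inter[OF D(1) this] show "E division_of (S \<inter> {u..v})"
    by (rule back_subst[of "\<lambda>E. E division_of _"]) (auto simp: E_def)
  fix G :: "real set \<Rightarrow> real" assume G: "\<And>c. G {c} = 0"
  have "sum G E = sum (G \<circ> (\<lambda>J. J \<inter> {u..v})) {J \<in> D. J \<inter> {u..v} \<noteq> {}}"
    unfolding E_def
  proof (rule sum.reindex_nontrivial)
    fix J K assume JK: "J \<in> {J \<in> D. J \<inter> {u..v} \<noteq> {}}" "K \<in> {J \<in> D. J \<inter> {u..v} \<noteq> {}}" "J \<noteq> K"
      and eq: "J \<inter> {u..v} = K \<inter> {u..v}"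
    then obtain c d where J: "J = {c..d}" using division_Icc_cases[OF D, of J] by blast
    then have L: "J \<inter> {u..v} = {max c u..min d v}" by (simp only: Int_atLeastAtMost)
    have "interior J \<inter> interior K = {}" using division_ofD(5)[OF D(1)] JK by blast
    moreover have "interior (J \<inter> {u..v}) \<subseteq> interior J" "interior (J \<inter> {u..v}) \<subseteq> interior K"
      using interior_mono[of "J \<inter> {u..v}" J] interior_mono[of "K \<inter> {u..v}" K] eq by auto
    ultimately have "interior {max c u..min d v} = {}" unfolding L by blast
    then have "{max c u<..<min d v} = {}" by simp
    then have "min d v \<le> max c u" unfolding greaterThanLessThan_empty_iff .
    moreover have "max c u \<le> min d v" using JK(1) by (simp only: mem_Collect_eq L atLeastatMost_empty_iff not_not)
    ultimately show "G (J \<inter> {u..v}) = 0" unfolding L using G by (metis antisym atLeastAtMost_singleton)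
  qed (use fin in auto)
  then show "sum G E = (\<Sum>J\<in>D. if J \<inter> {u..v} \<noteq> {} then G (J \<inter> {u..v}) else 0)"
    using fin by (simp add: sum.inter_filter)
qed

text \<open>A cell that straddles \<open>s\<close> is cut there and the triangle inequality is
  applied. Clipping to either side never increases the total length, so the smaller of the two
  moduli works.\<close>

lemma abs_continuous_on_Icc_concat:
  fixes x :: "real \<Rightarrow> 'a::real_normed_vector"
  assumes 1: "abs_continuous_on_Icc a s x" and 2: "abs_continuous_on_Icc s b x"
    and asb: "a \<le> s" "s \<le> b"
  shows "abs_continuous_on_Icc a b x"
  unfolding abs_continuous_on_Icc_def
proof (intro allI impI)
  fix e :: real assume "0 < e"
  then have e: "0 < e / 2" by simp
  obtain d1 where d1: "0 < d1" "\<And>D S. D division_of S \<Longrightarrow> S \<subseteq> {a..s} \<Longrightarrow> (\<Sum>J\<in>D. Sup J - Inf J) < d1 \<Longrightarrow>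
        (\<Sum>J\<in>D. norm (x (Sup J) - x (Inf J))) < e / 2"
    using abs_continuous_on_IccE[OF 1 e] by blast
  obtain d2 where d2: "0 < d2" "\<And>D S. D division_of S \<Longrightarrow> S \<subseteq> {s..b} \<Longrightarrow> (\<Sum>J\<in>D. Sup J - Inf J) < d2 \<Longrightarrow>
        (\<Sum>J\<in>D. norm (x (Sup J) - x (Inf J))) < e / 2"
    using abs_continuous_on_IccE[OF 2 e] by blast
  show "\<exists>\<delta>>0. \<forall>D S. D division_of S \<and> S \<subseteq> {a..b} \<and> (\<Sum>J\<in>D. Sup J - Inf J) < \<delta> \<longrightarrow>
        (\<Sum>J\<in>D. norm (x (Sup J) - x (Inf J))) < e"
  proof (intro exI[of _ "min d1 d2"] conjI allI impI; (elim conjE)?)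
    show "0 < min d1 d2" using d1 d2 by simp
    fix D S assume D: "D division_of S" "S \<subseteq> {a..b}" and len: "(\<Sum>J\<in>D. Sup J - Inf J) < min d1 d2"
    define G where "G J = norm (x (Sup J) - x (Inf J))" for J
    define E where "E u v = (\<lambda>J. J \<inter> {u..v}) ` {J \<in> D. J \<inter> {u..v} \<noteq> {}}" for u v
    note clip = division_clip[OF D, folded E_def]
    have short: "(\<Sum>J\<in>E u v. Sup J - Inf J) \<le> (\<Sum>J\<in>D. Sup J - Inf J)" if "u \<le> v" for u v
    proof -
      have "(\<Sum>J\<in>E u v. Sup J - Inf J) =
          (\<Sum>J\<in>D. if J \<inter> {u..v} \<noteq> {} then Sup (J \<inter> {u..v}) - Inf (J \<inter> {u..v}) else 0)"
        by (rule clip(2)[OF that]) simp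
      also have "\<dots> \<le> (\<Sum>J\<in>D. Sup J - Inf J)"
      proof (rule sum_mono)
        fix J assume "J \<in> D"
        then obtain c d where "J = {c..d}" "c \<le> d" using division_Icc_cases[OF D] by metis
        then show "(if J \<inter> {u..v} \<noteq> {} then Sup (J \<inter> {u..v}) - Inf (J \<inter> {u..v}) else 0) \<le> Sup J - Inf J"
          by auto
      qed
      finally show ?thesis .
    qed
    have G1: "sum G (E a s) < e / 2"
      unfolding G_def by (rule d1(2)[OF clip(1)[OF asb(1)]]) (use short[OF asb(1)] len in auto)
    have G2: "sum G (E s b) < e / 2"
      unfolding G_def by (rule d2(2)[OF clip(1)[OF asb(2)]]) (use short[OF asb(2)] len in auto)
    have "sum G D \<le> (\<Sum>J\<in>D. (if J \<inter> {a..s} \<noteq> {} then G (J \<inter> {a..s}) else 0) +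
        (if J \<inter> {s..b} \<noteq> {} then G (J \<inter> {s..b}) else 0))"
    proof (rule sum_mono)
      fix J assume "J \<in> D"
      then obtain c d where J: "J = {c..d}" "a \<le> c" "c \<le> d" "d \<le> b" using division_Icc_cases[OF D] by metis
      have G0: "0 \<le> G K" for K by (simp add: G_def)
      consider "d \<le> s" | "s \<le> c" | "c < s" "s < d" by linarith
      then show "G J \<le> (if J \<inter> {a..s} \<noteq> {} then G (J \<inter> {a..s}) else 0) +
        (if J \<inter> {s..b} \<noteq> {} then G (J \<inter> {s..b}) else 0)"
      proof cases
        case 1
        then have "J \<inter> {a..s} = J" "J \<noteq> {}" using J by auto
        then show ?thesis using G0 by simp
      next
        case 2
        then have "J \<inter> {s..b} = J" "J \<noteq> {}" using J by auto
        then show ?thesis using G0 by simp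
      next
        case 3
        then have "J \<inter> {a..s} = {c..s}" "J \<inter> {s..b} = {s..d}" using J by auto
        moreover have "norm (x d - x c) \<le> norm (x s - x c) + norm (x d - x s)"
          using norm_triangle_ineq[of "x s - x c" "x d - x s"] by simp
        ultimately show ?thesis using 3 J by (simp add: G_def)
      qed
    qed
    also have "\<dots> = sum G (E a s) + sum G (E s b)"
      using clip(2)[OF asb(1), of G] clip(2)[OF asb(2), of G] by (simp add: sum.distrib G_def)
    also have "\<dots> < e" using G1 G2 by simp
    finally show "(\<Sum>J\<in>D. norm (x (Sup J) - x (Inf J))) < e" by (simp add: G_def)
  qed
qed

lemma division_of_shift:
  fixes S :: "real set"
  assumes "D division_of S"
  shows "((\<lambda>J. (\<lambda>t. t - s) ` J) ` D) division_of ((\<lambda>t. t - s) ` S)"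
proof (rule division_ofI)
  have int: "interior ((\<lambda>t. t - s) ` J) = (\<lambda>t. t - s) ` interior J" for J
    using interior_translation[of "- s" J] by (simp add: image_image cong: image_cong_simp)
  fix K assume "K \<in> (\<lambda>J. (\<lambda>t. t - s) ` J) ` D"
  then obtain J where J: "J \<in> D" "K = (\<lambda>t. t - s) ` J" by blast
  show "K \<noteq> {}" "K \<subseteq> (\<lambda>t. t - s) ` S" using J division_ofD(2,3)[OF assms J(1)] by auto
  obtain c d where "J = cbox c d" using division_ofD(4)[OF assms J(1)] by blast
  then have "K = cbox (c - s) (d - s)" using J(2) by (simp add: image_diff_atLeastAtMost del: image_add_atLeastAtMost)
  then show "\<exists>a b. K = cbox a b" by blast
  fix L assume "L \<in> (\<lambda>J. (\<lambda>t. t - s) ` J) ` D" "K \<noteq> L"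
  then obtain J' where J': "J' \<in> D" "L = (\<lambda>t. t - s) ` J'" "J \<noteq> J'" using J by blast
  have "interior J \<inter> interior J' = {}" using division_ofD(5)[OF assms J(1) J'(1,3)] .
  then show "interior K \<inter> interior L = {}" unfolding J(2) J'(2) int by auto
qed (use division_ofD(1,6)[OF assms] in auto)

lemma abs_continuous_on_Icc_shift:
  assumes "abs_continuous_on_Icc (a - s) (b - s) x"
  shows "abs_continuous_on_Icc a b (\<lambda>t. x (t - s))"
  unfolding abs_continuous_on_Icc_def
proof (intro allI impI)
  fix e :: real assume "0 < e"
  then obtain d where d: "0 < d" "\<And>D S. D division_of S \<Longrightarrow> S \<subseteq> {a - s..b - s} \<Longrightarrow>
      (\<Sum>J\<in>D. Sup J - Inf J) < d \<Longrightarrow> (\<Sum>J\<in>D. norm (x (Sup J) - x (Inf J))) < e"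
    using abs_continuous_on_IccE[OF assms] by blast
  show "\<exists>\<delta>>0. \<forall>D S. D division_of S \<and> S \<subseteq> {a..b} \<and> (\<Sum>J\<in>D. Sup J - Inf J) < \<delta> \<longrightarrow>
        (\<Sum>J\<in>D. norm (x (Sup J - s) - x (Inf J - s))) < e"
  proof (intro exI[of _ d] conjI allI impI; (elim conjE)?)
    fix D S assume D: "D division_of S" "S \<subseteq> {a..b}" and len: "(\<Sum>J\<in>D. Sup J - Inf J) < d"
    let ?h = "\<lambda>J. (\<lambda>t. t - s) ` J"
    have inj: "inj_on ?h D"
      by (intro inj_onI) (simp add: inj_image_eq_iff inj_def)
    have ends: "Sup (?h J) = Sup J - s \<and> Inf (?h J) = Inf J - s" if "J \<in> D" for J
    proof -
      obtain u v where J: "J = {u..v}" "u \<le> v" using division_Icc_cases[OF D \<open>J \<in> D\<close>] by metis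
      have "?h {u..v} = {u - s..v - s}" by (simp add: image_diff_atLeastAtMost)
      then show ?thesis unfolding J(1) using J(2) by (simp only: cSup_atLeastAtMost cInf_atLeastAtMost diff_right_mono)
    qed
    have "(\<Sum>J\<in>?h ` D. norm (x (Sup J) - x (Inf J))) < e"
    proof (rule d(2)[OF division_of_shift[OF D(1)]])
      show "?h S \<subseteq> {a - s..b - s}" using D(2) by auto
      show "(\<Sum>J\<in>?h ` D. Sup J - Inf J) < d"
        using len ends by (simp add: sum.reindex[OF inj] cong: sum.cong)
    qed
    then show "(\<Sum>J\<in>D. norm (x (Sup J - s) - x (Inf J - s))) < e"
      using ends by (simp add: sum.reindex[OF inj] cong: sum.cong)
  qed (use d in auto)
qed

lemma has_vector_derivative_cong_Ioo:
  fixes x y :: "real \<Rightarrow> 'a::real_normed_vector"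
  assumes "(y has_vector_derivative v) (at t)" "t \<in> {a<..<b}" "\<And>s. s \<in> {a<..<b} \<Longrightarrow> y s = x s"
  shows "(x has_vector_derivative v) (at t)"
  using has_vector_derivative_transform_within_open[OF assms(1) open_greaterThanLessThan assms(2)] assms(3)
  by simp

text \<open>The witness may change with \<open>b\<close>, and its domain need only reach beyond
  \<open>b\<close>. This form serves unions of chains of arcs and limits of concatenations, where
  possibly no single earlier arc covers the whole domain.\<close>

lemma loc_abs_continuous_local:
  assumes "\<And>b. 0 \<le> b \<Longrightarrow> ereal b < T \<Longrightarrow>
    \<exists>S y. ereal b < S \<and> loc_abs_continuous S y \<and> (\<forall>t\<in>{0..b}. y t = x t)"
  shows "loc_abs_continuous T x"
  unfolding loc_abs_continuous_def
proof (intro allI impI)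
  fix a b assume ab: "{a..b} \<subseteq> time_dom T"
  show "abs_continuous_on_Icc a b x"
  proof (cases "a \<le> b")
    case True
    then have dom: "0 \<le> a" "ereal b < T" using ab by (auto simp: time_dom_def)
    then obtain S y where S: "ereal b < S" "loc_abs_continuous S y" "\<forall>t\<in>{0..b}. y t = x t"
      using assms[of b] True by auto
    have "{a..b} \<subseteq> time_dom S"
      using dom S(1) by (auto simp: time_dom_def) (meson ereal_less_eq(3) order_le_less_trans)
    then have "abs_continuous_on_Icc a b y" using S(2) by (simp add: loc_abs_continuous_def)
    then show ?thesis by (rule abs_continuous_on_Icc_cong) (use S(3) dom in auto)
  qed (simp add: abs_continuous_on_Icc_empty)
qed

section \<open>Joining two admissible pairs\<close>

lemma Linf_loc_bound:
  "Linf_loc T U u \<Longrightarrow> compact J \<Longrightarrow> J \<subseteq> time_dom T \<Longrightarrow> \<exists>B. AE t in lebesgue. t \<in> J \<longrightarrow> norm (u t) \<le> B"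
  by (auto simp: Linf_loc_def)

lemma Linf_loc_concat:
  fixes u1 u2 :: "real \<Rightarrow> 'b::euclidean_space"
  assumes u1: "Linf_loc T1 U u1" and u2: "Linf_loc T2 U u2"
    and s: "0 \<le> s" "ereal s < T1" and T2: "0 < T2"
  shows "Linf_loc (ereal s + T2) U (\<lambda>t. if t < s then u1 t else u2 (t - s))"
proof -
  let ?T = "ereal s + T2" and ?u = "\<lambda>t. if t < s then u1 t else u2 (t - s)"
  have lt: "t \<in> time_dom T1" if "0 \<le> t" "t \<le> s" for t
    using that s(2) by (auto simp: time_dom_def) (meson ereal_less_eq(3) order_le_less_trans)
  have ge: "t \<in> time_dom ?T \<longleftrightarrow> t - s \<in> time_dom T2" if "s \<le> t" for t
    by (rule time_dom_shift[OF T2 that s(1)])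
  have lt': "t \<in> time_dom ?T \<longleftrightarrow> 0 \<le> t" if "t < s" for t
    using that T2 s(1) by (cases T2) (auto simp: time_dom_def)
  have [measurable]: "(\<lambda>t. indicator (time_dom T1) t *\<^sub>R u1 t) \<in> borel_measurable lebesgue"
    and v2: "(\<lambda>t. indicator (time_dom T2) t *\<^sub>R u2 t) \<in> borel_measurable lebesgue"
    using u1 u2 by (auto simp: Linf_loc_def set_borel_measurable_def)
  have "(\<lambda>t::real. - s + t) \<in> lebesgue \<rightarrow>\<^sub>M lebesgue"
    using lebesgue_affine_measurable[where c = "\<lambda>_::real. 1" and t = "- s"] by simp
  from measurable_compose[OF this v2]
  have [measurable]: "(\<lambda>t. indicator (time_dom T2) (t - s) *\<^sub>R u2 (t - s)) \<in> borel_measurable lebesgue"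
    by simp
  have "(\<lambda>t. indicator (time_dom ?T) t *\<^sub>R ?u t) = (\<lambda>t. if t \<in> {..<s} then indicator (time_dom T1) t *\<^sub>R u1 t
      else indicator (time_dom T2) (t - s) *\<^sub>R u2 (t - s))"
  proof
    fix t
    have "t \<in> time_dom T1 \<longleftrightarrow> 0 \<le> t" if "t < s" using that lt[of t] by (auto simp: time_dom_def)
    then show "indicator (time_dom ?T) t *\<^sub>R ?u t = (if t \<in> {..<s} then indicator (time_dom T1) t *\<^sub>R u1 t
      else indicator (time_dom T2) (t - s) *\<^sub>R u2 (t - s))"
      using ge[of t] lt'[of t] by (auto simp: indicator_def)
  qed
  also have "\<dots> \<in> borel_measurable lebesgue"
    by (rule measurable_If_set) auto
  finally have meas: "set_borel_measurable lebesgue (time_dom ?T) ?u"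
    by (simp add: set_borel_measurable_def)
  have inU: "?u t \<in> U" if "t \<in> time_dom ?T" for t
  proof (cases "t < s")
    case True
    then have "t \<in> time_dom T1" using that lt'[of t] lt[of t] by auto
    then show ?thesis using True u1 by (simp add: Linf_loc_def)
  qed (use that ge[of t] u2 in \<open>simp add: Linf_loc_def\<close>)
  have "\<exists>B. AE t in lebesgue. t \<in> J \<longrightarrow> norm (?u t) \<le> B" if J: "compact J" "J \<subseteq> time_dom ?T" for J
  proof -
    \<comment> \<open>The closed half-line keeps the set compact; it still lies in the first domain
      because \<open>s < T1\<close>.\<close>
    have "compact (J \<inter> {..s})" using J by (intro compact_Int_closed) auto
    moreover have "J \<inter> {..s} \<subseteq> time_dom T1"
      using J(2) lt by (auto simp: time_dom_def)
    ultimately obtain B1 where B1: "AE t in lebesgue. t \<in> J \<inter> {..s} \<longrightarrow> norm (u1 t) \<le> B1"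
      using Linf_loc_bound[OF u1] by blast
    have "compact ((\<lambda>t. t - s) ` (J \<inter> {s..}))"
      using J by (intro compact_continuous_image compact_Int_closed continuous_intros) auto
    moreover have "(\<lambda>t. t - s) ` (J \<inter> {s..}) \<subseteq> time_dom T2"
      using J(2) ge by auto
    ultimately obtain B2 where B2: "AE t in lebesgue. t \<in> (\<lambda>t. t - s) ` (J \<inter> {s..}) \<longrightarrow> norm (u2 t) \<le> B2"
      using Linf_loc_bound[OF u2] by blast
    from B1 AE_lebesgue_shift[OF B2, of s]
    have "AE t in lebesgue. t \<in> J \<longrightarrow> norm (?u t) \<le> max B1 B2"
      by eventually_elim (auto simp: le_max_iff_disj)
    then show ?thesis by blast
  qed
  then show ?thesis using meas inU unfolding Linf_loc_def by blast
qed

lemma loc_abs_continuous_concat: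
  assumes x1: "loc_abs_continuous T1 x1" and x2: "loc_abs_continuous T2 x2"
    and s: "0 \<le> s" "ereal s < T1" and T2: "0 < T2" and eq: "x2 0 = x1 s"
  shows "loc_abs_continuous (ereal s + T2) (\<lambda>t. if t < s then x1 t else x2 (t - s))"
  unfolding loc_abs_continuous_def
proof (intro allI impI)
  let ?x = "\<lambda>t. if t < s then x1 t else x2 (t - s)"
  fix a b assume ab: "{a..b} \<subseteq> time_dom (ereal s + T2)"
  have left: "abs_continuous_on_Icc c d ?x" if "0 \<le> c" "d \<le> s" for c d
  proof (rule abs_continuous_on_Icc_cong)
    have "{c..d} \<subseteq> time_dom T1"
      using that s(2) by (auto simp: time_dom_def) (meson ereal_less_eq(3) order_le_less_trans order_trans)
    then show "abs_continuous_on_Icc c d x1" using x1 by (simp add: loc_abs_continuous_def)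
    \<comment> \<open>At the junction the glued function takes the value \<open>x2 0\<close>, which
      equals \<open>x1 s\<close>.\<close>
    show "x1 t = ?x t" if "t \<in> {c..d}" for t
      using that \<open>d \<le> s\<close> eq by (cases "t = s") auto
  qed
  have right: "abs_continuous_on_Icc c b ?x" if "s \<le> c" "a \<le> c" for c
  proof (rule abs_continuous_on_Icc_cong)
    have "{c - s..b - s} \<subseteq> time_dom T2"
    proof
      fix t assume "t \<in> {c - s..b - s}"
      then have "t + s \<in> {a..b}" "s \<le> t + s" using that by auto
      then show "t \<in> time_dom T2" using ab time_dom_shift[OF T2 _ s(1), of "t + s"] by auto
    qed
    then have "abs_continuous_on_Icc (c - s) (b - s) x2" using x2 by (simp add: loc_abs_continuous_def)
    then show "abs_continuous_on_Icc c b (\<lambda>t. x2 (t - s))" by (rule abs_continuous_on_Icc_shift)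
  qed (use that in auto)
  consider "b < a" | "a \<le> b" "b \<le> s" | "s \<le> a" | "a \<le> s" "s \<le> b" by linarith
  then show "abs_continuous_on_Icc a b ?x"
  proof cases
    case 1
    then show ?thesis by (rule abs_continuous_on_Icc_empty)
  next
    case 2
    then have "a \<in> {a..b}" by simp
    then have "0 \<le> a" using ab by (auto simp: time_dom_def)
    then show ?thesis using 2(2) by (rule left)
  next
    case 3
    then show ?thesis by (rule right) simp
  next
    case 4
    then have "a \<in> {a..b}" by simp
    then have "0 \<le> a" using ab by (auto simp: time_dom_def)
    from abs_continuous_on_Icc_concat[OF left[OF this order_refl] right[OF order_refl 4(1)] 4]
    show ?thesis .
  qed
qed

text \<open>The first pair is left strictly before its end and contributes only a bounded piece. The
  approach to the target and the extension beyond it are those of the second pair, shifted by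
  \<open>s\<close>. The derivative may fail to exist at the junction, which is a null set.\<close>

lemma admissible_concat:
  assumes adm1: "admissible_pair f C U T1 x1 u1" and adm2: "admissible_pair f C U T2 x2 u2"
    and s: "0 < s" "ereal s < T1" and eq: "x2 0 = x1 s"
  shows "admissible_pair f C U (ereal s + T2)
    (\<lambda>t. if t < s then x1 t else x2 (t - s)) (\<lambda>t. if t < s then u1 t else u2 (t - s))"
    (is "admissible_pair f C U ?T ?x ?u")
proof -
  have T2: "0 < T2" using adm2 by (simp add: admissible_pair_def)
  have s0: "0 \<le> s" using s by simp
  have lt: "t \<in> time_dom T1" if "0 \<le> t" "t \<le> s" for t
    using that s(2) by (auto simp: time_dom_def) (meson ereal_less_eq(3) order_le_less_trans)
  have ge: "t \<in> time_dom ?T \<longleftrightarrow> t - s \<in> time_dom T2" if "s \<le> t" for t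
    by (rule time_dom_shift[OF T2 that s0])
  have pos: "0 < ?T" using s(1) T2 by (cases T2) auto
  have Linf: "Linf_loc ?T U ?u"
    using adm1 adm2 s0 s(2) T2 by (intro Linf_loc_concat) (auto simp: admissible_pair_def)
  have lac: "loc_abs_continuous ?T ?x"
    using adm1 adm2 s0 s(2) T2 eq by (intro loc_abs_continuous_concat) (auto simp: admissible_pair_def)
  have notC: "?x t \<notin> C" if t: "t \<in> time_dom ?T" for t
  proof (cases "t < s")
    case True
    then have "t \<in> time_dom T1" using t lt[of t] by (simp add: time_dom_def)
    then show ?thesis using True adm1 by (simp add: admissible_pair_def)
  qed (use t ge[of t] adm2 in \<open>simp add: admissible_pair_def\<close>)
  have d1: "AE t in lebesgue. t \<in> time_dom T1 \<longrightarrow> (x1 has_vector_derivative f (x1 t) (u1 t)) (at t)"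
    using adm1 by (simp add: admissible_pair_def)
  have d2: "AE t in lebesgue. t \<in> time_dom T2 \<longrightarrow> (x2 has_vector_derivative f (x2 t) (u2 t)) (at t)"
    using adm2 by (simp add: admissible_pair_def)
  have der: "AE t in lebesgue. t \<in> time_dom ?T \<longrightarrow> (?x has_vector_derivative f (?x t) (?u t)) (at t)"
    using d1 AE_lebesgue_shift[OF d2, of s] AE_lebesgue_neq[of s]
  proof eventually_elim
    case (elim t)
    show ?case
    proof
      assume t: "t \<in> time_dom ?T"
      show "(?x has_vector_derivative f (?x t) (?u t)) (at t)"
      proof (cases "t < s")
        case True
        then have "(x1 has_vector_derivative f (x1 t) (u1 t)) (at t)"
          using elim(1) t lt[of t] by (simp add: time_dom_def)
        then have "(?x has_vector_derivative f (x1 t) (u1 t)) (at t)"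
          by (rule has_vector_derivative_cong_Ioo[of _ _ _ "t - 1" s]) (use True in auto)
        then show ?thesis using True by simp
      next
        case False
        then have ts: "s < t" using elim(3) by simp
        have "(x2 has_vector_derivative f (x2 (t - s)) (u2 (t - s))) (at (t - s))"
          using elim(2) t ge[of t] ts by simp
        moreover have "((\<lambda>t. t - s) has_vector_derivative 1) (at t)"
          by (auto intro!: derivative_eq_intros)
        ultimately have "(x2 \<circ> (\<lambda>t. t - s) has_vector_derivative 1 *\<^sub>R f (x2 (t - s)) (u2 (t - s))) (at t)"
          by (intro vector_diff_chain_at)
        then have "(?x has_vector_derivative 1 *\<^sub>R f (x2 (t - s)) (u2 (t - s))) (at t)"
          by (rule has_vector_derivative_cong_Ioo[of _ _ _ s "t + 1"]) (use ts in auto)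
        then show ?thesis using ts by simp
      qed
    qed
  qed
  have fin: "reaches_target C ?T ?x \<and> extended_by_limit C ?T ?x" if "?T < \<infinity>"
  proof -
    obtain \<theta> where \<theta>: "T2 = ereal \<theta>" using \<open>?T < \<infinity>\<close> T2 by (cases T2) auto
    have \<theta>0: "0 < \<theta>" using T2 \<theta> by simp
    have re: "reaches_target C T2 x2" and ex: "extended_by_limit C T2 x2"
      using adm2 \<theta> by (auto simp: admissible_pair_def)
    have at_shift: "at_left \<theta> = filtermap (\<lambda>t. t - s) (at_left (\<theta> + s))"
      using filtermap_at_left_shift[of s "\<theta> + s"] by simp
    have "((\<lambda>t. infdist (x2 t) C) \<longlongrightarrow> 0) (at_left \<theta>)" using re \<theta> by (simp add: reaches_target_def)
    then have "((\<lambda>t. infdist (x2 (t - s)) C) \<longlongrightarrow> 0) (at_left (\<theta> + s))"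
      unfolding at_shift filterlim_filtermap .
    moreover have "\<forall>\<^sub>F t in at_left (\<theta> + s). infdist (x2 (t - s)) C = infdist (?x t) C"
      using eventually_at_left_real[of s "\<theta> + s"] \<theta>0 by (auto elim!: eventually_mono)
    ultimately have "((\<lambda>t. infdist (?x t) C) \<longlongrightarrow> 0) (at_left (\<theta> + s))"
      using tendsto_cong by force
    then have 1: "reaches_target C ?T ?x" by (simp add: reaches_target_def \<theta> add.commute)
    obtain z \<tau> where z: "z \<in> frontier C" "\<forall>t. T2 \<le> ereal t \<longrightarrow> x2 t = z"
      and \<tau>: "strict_mono \<tau>" "\<And>i. \<tau> i \<in> time_dom T2" "(\<lambda>i. ereal (\<tau> i)) \<longlonglongrightarrow> T2" "(\<lambda>i. x2 (\<tau> i)) \<longlonglongrightarrow> z"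
      using ex unfolding extended_by_limit_def by metis
    have \<tau>0: "0 \<le> \<tau> i" for i using \<tau>(2) by (simp add: time_dom_def)
    have "extended_by_limit C ?T ?x"
      unfolding extended_by_limit_def
    proof (intro bexI[OF _ z(1)] conjI exI[of _ "\<lambda>i. \<tau> i + s"] allI impI)
      show "strict_mono (\<lambda>i. \<tau> i + s)" using \<tau>(1) by (simp add: strict_mono_def)
      show "\<tau> i + s \<in> time_dom ?T" for i using ge[of "\<tau> i + s"] \<tau>(2) \<tau>0 by simp
      have "(\<lambda>i. \<tau> i + s) \<longlonglongrightarrow> \<theta> + s" using \<tau>(3) \<theta> by (intro tendsto_intros) simp
      then show "(\<lambda>i. ereal (\<tau> i + s)) \<longlonglongrightarrow> ?T" by (simp add: \<theta> add.commute)
      have "?x (\<tau> i + s) = x2 (\<tau> i)" for i using \<tau>0[of i] by simp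
      then show "(\<lambda>i. ?x (\<tau> i + s)) \<longlonglongrightarrow> z" using \<tau>(4) by (simp only:)
      fix t assume "?T \<le> ereal t"
      then have "T2 \<le> ereal (t - s)" "\<not> t < s" using \<theta> \<theta>0 by auto
      then show "?x t = z" using z(2) by simp
    qed
    then show ?thesis using 1 by blast
  qed
  show ?thesis
    unfolding admissible_pair_def using pos Linf notC lac der fin by blast
qed

section \<open>Existence of sampling trajectories\<close>

lemma time_dom_less: "0 \<le> s \<Longrightarrow> s \<le> t \<Longrightarrow> t \<in> time_dom T \<Longrightarrow> s \<in> time_dom T"
  by (auto simp: time_dom_def) (meson ereal_less_eq(3) order_le_less_trans)

text \<open>Every clause concerns initial compact intervals. This includes the sampled value
  \<open>x (\<pi> k)\<close>: it matters only at times \<open>t \<ge> \<pi> k \<ge> 0\<close>, hence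
  is fixed by the restriction to \<open>{0..b}\<close> for \<open>b > t\<close>. The union of a
  chain of arcs is an arc for this reason.\<close>

lemma sampling_arc_local:
  assumes \<pi>: "\<And>k. 0 \<le> \<pi> k"
    and loc: "\<And>b. 0 \<le> b \<Longrightarrow> ereal b < T \<Longrightarrow>
      \<exists>S y. ereal b < S \<and> sampling_arc f C K \<pi> S y \<and> (\<forall>t\<in>{0..b}. y t = x t)"
  shows "sampling_arc f C K \<pi> T x"
  unfolding sampling_arc_def
proof (intro conjI allI ballI)
  show "continuous_on (time_dom T) x"
    unfolding continuous_on_eq_continuous_within
  proof
    fix t assume "t \<in> time_dom T"
    then have t: "0 \<le> t" "ereal t < T" by (auto simp: time_dom_def)
    obtain b where b: "ereal t < ereal b" "ereal b < T"
      using ereal_dense3[OF t(2)] by auto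
    then obtain S y where S: "ereal b < S" "sampling_arc f C K \<pi> S y" "\<forall>t\<in>{0..b}. y t = x t"
      using loc[of b] t by auto
    have "b \<in> time_dom S" using S(1) t b by (simp add: time_dom_def)
    then have "{0..b} \<subseteq> time_dom S" using time_dom_less[of _ b S] by auto
    then have "continuous_on {0..b} y" using S(2) continuous_on_subset unfolding sampling_arc_def by blast
    then have "continuous_on {0..b} x" using S(3) continuous_on_cong by fastforce
    then have "continuous (at t within {0..b}) x"
      using t b by (simp add: continuous_on_eq_continuous_within)
    \<comment> \<open>Choosing \<open>b\<close> strictly between \<open>t\<close> and
      \<open>T\<close> makes the two sets agree near \<open>t\<close>.\<close>
    moreover have "at t within {0..b} = at t within time_dom T"
    proof (rule at_within_nhd[of t "{..<b}"])
      have "s \<in> time_dom T" if "0 \<le> s" "s < b" for s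
        using time_dom_less[of s b T] that b by (simp add: time_dom_def)
      then show "{0..b} \<inter> {..<b} - {t} = time_dom T \<inter> {..<b} - {t}"
        by (auto simp: time_dom_def)
    qed (use b in auto)
    ultimately show "continuous (at t within time_dom T) x" by simp
  qed
  show "loc_abs_continuous T x"
    by (rule loc_abs_continuous_local) (use loc in \<open>unfold sampling_arc_def, meson\<close>)
  show "x t \<notin> C" if "t \<in> time_dom T" for t
  proof -
    obtain S y where "ereal t < S" "sampling_arc f C K \<pi> S y" "\<forall>s\<in>{0..t}. y s = x s"
      using loc[of t] \<open>t \<in> time_dom T\<close> by (auto simp: time_dom_def)
    then show ?thesis using that by (auto simp: sampling_arc_def time_dom_def)
  qed
  fix k
  have "AE t in lebesgue. t \<in> time_dom T \<longrightarrow> (t \<in> {\<pi> k..\<pi> (Suc k)} \<longrightarrow>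
      (x has_vector_derivative f (x t) (K (x (\<pi> k)))) (at t))"
  proof (rule AE_time_dom)
    fix b assume b: "ereal b < T"
    show "AE t in lebesgue. t \<in> {0<..<b} \<longrightarrow> (t \<in> {\<pi> k..\<pi> (Suc k)} \<longrightarrow>
      (x has_vector_derivative f (x t) (K (x (\<pi> k)))) (at t))"
    proof (cases "0 \<le> b")
      case True
      then obtain S y where S: "ereal b < S" "sampling_arc f C K \<pi> S y" "\<forall>t\<in>{0..b}. y t = x t"
        using loc b by blast
      have dom: "b \<in> time_dom S" using S(1) True by (simp add: time_dom_def)
      have "AE t in lebesgue. t \<in> {\<pi> k..\<pi> (Suc k)} \<inter> time_dom S \<longrightarrow>
        (y has_vector_derivative f (y t) (K (y (\<pi> k)))) (at t)"
        using S(2) by (simp add: sampling_arc_def)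
      then show ?thesis
      proof eventually_elim
        case (elim t)
        show ?case
        proof (intro impI)
          assume t: "t \<in> {0<..<b}" "t \<in> {\<pi> k..\<pi> (Suc k)}"
          then have "(y has_vector_derivative f (y t) (K (y (\<pi> k)))) (at t)"
            using elim time_dom_less[OF _ _ dom, of t] by auto
          then have "(x has_vector_derivative f (y t) (K (y (\<pi> k)))) (at t)"
            by (rule has_vector_derivative_cong_Ioo[OF _ t(1)]) (use S(3) in auto)
          moreover have "y t = x t" "y (\<pi> k) = x (\<pi> k)" using S(3) t \<pi>[of k] by auto
          ultimately show "(x has_vector_derivative f (x t) (K (x (\<pi> k)))) (at t)" by simp
        qed
      qed
    qed auto
  qed
  then show "AE t in lebesgue. t \<in> {\<pi> k..\<pi> (Suc k)} \<inter> time_dom T \<longrightarrow>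
        (x has_vector_derivative f (x t) (K (x (\<pi> k)))) (at t)"
    by eventually_elim blast
qed

lemma sampling_arc_cong:
  assumes "\<And>k. 0 \<le> \<pi> k" "sampling_arc f C K \<pi> T x" "\<And>t. t \<in> time_dom T \<Longrightarrow> x t = y t"
  shows "sampling_arc f C K \<pi> T y"
proof (rule sampling_arc_local)
  fix b assume "0 \<le> b" "ereal b < T"
  then have "{0..b} \<subseteq> time_dom T" using time_dom_less[of _ b T] by (auto simp: time_dom_def)
  then show "\<exists>S x. ereal b < S \<and> sampling_arc f C K \<pi> S x \<and> (\<forall>t\<in>{0..b}. x t = y t)"
    using assms(2,3) \<open>ereal b < T\<close> by (intro exI[of _ T] exI[of _ x]) auto
qed fact

lemma maximal_sampling_arc:
  fixes x0 :: "real \<Rightarrow> 'a::euclidean_space"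
  assumes \<pi>: "\<And>k. 0 \<le> \<pi> k" and T0: "0 < T0" and x0: "sampling_arc f C K \<pi> T0 x0"
  obtains T x where "0 < T" "sampling_arc f C K \<pi> T x" "x 0 = x0 0"
    "\<not> (\<exists>T' y. T < T' \<and> sampling_arc f C K \<pi> T' y \<and> (\<forall>t\<in>time_dom T. y t = x t))"
proof -
  define z where "z = x0 0"
  \<comment> \<open>Extension compares values on time domains only, so it is not antisymmetric on
    total functions. Prescribing the value \<open>z\<close> outside the domain makes it so.\<close>
  define nrm where "nrm T x t = (if t \<in> time_dom T then x t else z)" for T and x :: "real \<Rightarrow> 'a" and t
  define A where "A = {(T, x). 0 < T \<and> sampling_arc f C K \<pi> T x \<and> x 0 = z \<and> nrm T x = x}"
  define P where "P p q \<longleftrightarrow> fst p \<le> fst q \<and> (\<forall>t\<in>time_dom (fst p). snd q t = snd p t)"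
    for p q :: "ereal \<times> (real \<Rightarrow> 'a)"
  have sub: "time_dom S \<subseteq> time_dom T" if "S \<le> T" for S T
    using that by (auto simp: time_dom_def)
  have nrmA: "(T, nrm T x) \<in> A" if "0 < T" "sampling_arc f C K \<pi> T x" "x 0 = z" for T x
    using that sampling_arc_cong[OF \<pi> that(2), of "nrm T x"] by (auto simp: A_def nrm_def)
  have "\<exists>m\<in>A. \<forall>a\<in>A. P m a \<longrightarrow> a = m"
  proof (rule predicate_Zorn)
    have "antisym (relation_of P A)"
    proof (rule antisymI)
      fix p q assume "(p, q) \<in> relation_of P A" "(q, p) \<in> relation_of P A"
      then have pq: "p \<in> A" "q \<in> A" "P p q" "P q p" by (auto simp: relation_of_def)
      obtain S x T y where eq: "p = (S, x)" "q = (T, y)" by (metis surj_pair)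
      have "S = T" "\<forall>t\<in>time_dom S. y t = x t"
        using pq by (auto simp: P_def eq)
      moreover have "x = nrm S x" "y = nrm T y" using pq by (auto simp: A_def eq)
      ultimately have "x t = y t" for t by (metis nrm_def)
      then show "p = q" using \<open>S = T\<close> by (auto simp: eq)
    qed
    moreover have "trans (relation_of P A)"
    proof (rule transI)
      fix p q r assume "(p, q) \<in> relation_of P A" "(q, r) \<in> relation_of P A"
      then show "(p, r) \<in> relation_of P A"
        using sub by (fastforce simp: relation_of_def P_def)
    qed
    moreover have "refl_on A (relation_of P A)" "relation_of P A \<subseteq> A \<times> A"
      by (auto simp: refl_on_def relation_of_def P_def)
    ultimately show "partial_order_on A (relation_of P A)"
      by (simp add: partial_order_on_def preorder_on_def)
  next
    fix Ch assume Ch: "Ch \<in> Chains (relation_of P A)"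
    have ChA: "p \<in> A" if "p \<in> Ch" for p
      using Ch that by (auto simp: Chains_def relation_of_def)
    have comp: "P p q \<or> P q p" if "p \<in> Ch" "q \<in> Ch" for p q
      using Ch that by (auto simp: Chains_def relation_of_def)
    show "\<exists>u\<in>A. \<forall>a\<in>Ch. P a u"
    proof (cases "Ch = {}")
      case True
      \<comment> \<open>The initial arc enters here, as an upper bound of the empty chain.\<close>
      then show ?thesis using nrmA[OF T0 x0] by (auto simp: z_def)
    next
      case False
      define T where "T = (SUP p\<in>Ch. fst p)"
      \<comment> \<open>Any two members of the chain agree wherever both are defined, so the choice
        of the member does not affect the value.\<close>
      define x where "x t = snd (SOME p. p \<in> Ch \<and> t \<in> time_dom (fst p)) t" for t
      have x: "x t = snd p t" if p: "p \<in> Ch" "t \<in> time_dom (fst p)" for p t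
      proof -
        have q: "(SOME p. p \<in> Ch \<and> t \<in> time_dom (fst p)) \<in> Ch \<and> t \<in> time_dom (fst (SOME p. p \<in> Ch \<and> t \<in> time_dom (fst p)))"
          by (rule someI[of _ p]) (use p in simp)
        with comp[OF p(1) conjunct1[OF q]] p(2) show ?thesis
          unfolding x_def P_def by auto
      qed
      have arc: "sampling_arc f C K \<pi> T x"
      proof (rule sampling_arc_local[OF \<pi>])
        fix b assume b: "0 \<le> b" "ereal b < T"
        then obtain p where p: "p \<in> Ch" "ereal b < fst p" unfolding T_def less_SUP_iff by blast
        then have "t \<in> time_dom (fst p)" if "t \<in> {0..b}" for t
          using that time_dom_less[of t b "fst p"] b by (auto simp: time_dom_def)
        moreover have "sampling_arc f C K \<pi> (fst p) (snd p)" using ChA[OF p(1)] by (auto simp: A_def)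
        ultimately show "\<exists>S y. ereal b < S \<and> sampling_arc f C K \<pi> S y \<and> (\<forall>t\<in>{0..b}. y t = x t)"
          using x[OF p(1)] p(2) by (intro exI[of _ "fst p"] exI[of _ "snd p"]) auto
      qed
      have le: "fst p \<le> T" if "p \<in> Ch" for p unfolding T_def using that by (rule SUP_upper)
      obtain p where p: "p \<in> Ch" using False by blast
      have p0: "0 < fst p" "snd p 0 = z" using ChA[OF p] by (auto simp: A_def)
      then have "x 0 = z" "0 < T" using x[OF p, of 0] le[OF p] by (auto simp: time_dom_def zero_ereal_def)
      then have "(T, nrm T x) \<in> A" using nrmA arc by blast
      moreover have "P q (T, nrm T x)" if "q \<in> Ch" for q
        using le[OF that] x[OF that] sub[OF le[OF that]] by (auto simp: P_def nrm_def)
      ultimately show ?thesis by blast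
    qed
  qed
  then obtain T x where m: "(T, x) \<in> A" "\<And>a. a \<in> A \<Longrightarrow> P (T, x) a \<Longrightarrow> a = (T, x)"
    by (auto simp: A_def)
  show thesis
  proof (rule that)
    show "0 < T" "sampling_arc f C K \<pi> T x" "x 0 = x0 0" using m(1) by (auto simp: A_def z_def)
    show "\<not> (\<exists>T' y. T < T' \<and> sampling_arc f C K \<pi> T' y \<and> (\<forall>t\<in>time_dom T. y t = x t))"
    proof
      assume "\<exists>T' y. T < T' \<and> sampling_arc f C K \<pi> T' y \<and> (\<forall>t\<in>time_dom T. y t = x t)"
      then obtain T' y where y: "T < T'" "sampling_arc f C K \<pi> T' y" "\<forall>t\<in>time_dom T. y t = x t" by blast
      have "0 \<in> time_dom T" using \<open>0 < T\<close> by (simp add: time_dom_def zero_ereal_def)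
      then have "y 0 = z" using y(3) m(1) by (auto simp: A_def)
      then have "(T', nrm T' y) \<in> A" using nrmA[of T' y] y \<open>0 < T\<close> by auto
      moreover have "P (T, x) (T', nrm T' y)" using y sub[OF less_imp_le[OF y(1)]] by (auto simp: P_def nrm_def)
      ultimately show False using m(2) y(1) by fastforce
    qed
  qed
qed

text \<open>\<open>C\<close> may be unbounded, so closeness to \<open>C\<close> alone gives no
  compactness. A segment from \<open>x n\<close> to a nearest point of \<open>C\<close> meets the
  frontier within distance \<open>infdist (x n) C\<close> of \<open>x n\<close>, and the compact
  frontier then provides the limit.\<close>

lemma frontier_cluster_point:
  fixes x :: "nat \<Rightarrow> 'a::euclidean_space"
  assumes "closed C" "C \<noteq> {}" "compact (frontier C)"
    and x: "\<And>n. x n \<notin> C" and lim: "(\<lambda>n. infdist (x n) C) \<longlonglongrightarrow> 0"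
  obtains r z where "strict_mono (r :: nat \<Rightarrow> nat)" "z \<in> frontier C" "(x \<circ> r) \<longlonglongrightarrow> z"
proof -
  have "\<exists>w\<in>frontier C. dist (x n) w \<le> infdist (x n) C" for n
  proof -
    obtain c where c: "c \<in> C" "infdist (x n) C = dist (x n) c"
      using infdist_attains_inf[OF assms(1,2)] by blast
    have "closed_segment (x n) c \<inter> frontier C \<noteq> {}"
      using c(1) x[of n] by (intro connected_Int_frontier connected_segment) auto
    then obtain w where w: "w \<in> closed_segment (x n) c" "w \<in> frontier C" by blast
    then show ?thesis using dist_in_closed_segment[OF w(1)] c(2) by (auto simp: dist_commute)
  qed
  then obtain w where w: "\<And>n. w n \<in> frontier C" "\<And>n. dist (x n) (w n) \<le> infdist (x n) C" by metis
  obtain z r where r: "z \<in> frontier C" "strict_mono (r :: nat \<Rightarrow> nat)" "(w \<circ> r) \<longlonglongrightarrow> z"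
    using assms(3) w(1) unfolding compact_def by metis
  have "(\<lambda>n. dist (x n) (w n)) \<longlonglongrightarrow> 0"
    using w(2) by (intro Lim_null_comparison[OF _ lim]) simp
  then have "(\<lambda>n. dist ((x \<circ> r) n) ((w \<circ> r) n)) \<longlonglongrightarrow> 0"
    using LIMSEQ_subseq_LIMSEQ[OF _ r(2)] by (fastforce simp: o_def)
  then have "(\<lambda>n. (x \<circ> r) n - (w \<circ> r) n) \<longlonglongrightarrow> 0"
    unfolding dist_norm by (rule tendsto_norm_zero_cancel)
  then have "(x \<circ> r) \<longlonglongrightarrow> z" by (rule Lim_transform[OF r(3)])
  with r(2,1) show thesis by (rule that)
qed

text \<open>One Peano arc with the constant control \<open>K z\<close> starts the procedure and
  maximality replaces the recursion over the later steps; nothing is claimed about the life span. If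
  the arc approaches the target in finite time, its later values are replaced by a frontier cluster
  point.\<close>

lemma sampling_pair_exists:
  fixes f :: "'a::euclidean_space \<Rightarrow> 'b::euclidean_space \<Rightarrow> 'a"
  assumes C: "closed C" "C \<noteq> {}" "compact (frontier C)"
    and f: "continuous_on ((- C) \<times> U) (\<lambda>(x, u). f x u)"
    and K: "\<And>z. z \<notin> C \<Longrightarrow> K z \<in> U" and z: "z \<notin> C" and \<pi>: "time_partition \<pi>"
  shows "\<exists>T x u. sampling_pair f C K \<pi> T x u \<and> x 0 = z"
proof -
  have mono: "strict_mono \<pi>" and \<pi>0: "\<pi> 0 = 0"
    using \<pi> by (auto simp: time_partition_def strict_mono_Suc_iff)
  have nn: "0 \<le> \<pi> k" for k using strict_mono_leD[OF mono, of 0 k] \<pi>0 by simp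
  have "continuous_on (- C) (\<lambda>x. f x (K z))"
    using K[OF z] by (intro continuous_on_compose2[OF f, of _ "\<lambda>x. (x, K z)", simplified]) (auto intro!: continuous_intros)
  then obtain T0 B y where y: "0 < T0" "B-lipschitz_on {0..T0} y" "y 0 = z" "y ` {0..T0} \<subseteq> - C"
    "\<And>t. t \<in> {0<..<T0} \<Longrightarrow> (y has_vector_derivative f (y t) (K z)) (at t)"
    using peano_local[of "- C" "\<lambda>x. f x (K z)" z] z C(1) by (auto simp: open_Compl)
  \<comment> \<open>Cutting at \<open>\<pi> 1\<close> leaves the sample taken at time 0 as the only
    one in force on the domain.\<close>
  define T1 where "T1 = min T0 (\<pi> 1)"
  have T1: "0 < T1" "T1 \<le> T0" using y(1) strict_mono_less[OF mono, of 0 1] \<pi>0 by (auto simp: T1_def)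
  have dom: "time_dom (ereal T1) = {0..<T1}" by (auto simp: time_dom_def)
  have arc1: "sampling_arc f C K \<pi> (ereal T1) y"
    unfolding sampling_arc_def dom
  proof (intro conjI allI ballI)
    show "continuous_on {0..<T1} y"
      by (rule continuous_on_subset[OF lipschitz_on_continuous_on[OF y(2)]]) (use T1 in auto)
    show "loc_abs_continuous (ereal T1) y"
      unfolding loc_abs_continuous_def dom
    proof (intro allI impI)
      fix a b assume "{a..b} \<subseteq> {0..<T1}"
      then have "{a..b} \<subseteq> {0..T0}" using T1(2) by fastforce
      then show "abs_continuous_on_Icc a b y"
        using abs_continuous_on_Icc_lipschitz lipschitz_on_subset[OF y(2)] by blast
    qed
    show "y t \<notin> C" if "t \<in> {0..<T1}" for t using y(4) that T1(2) by fastforce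
    fix k
    show "AE t in lebesgue. t \<in> {\<pi> k..\<pi> (Suc k)} \<inter> {0..<T1} \<longrightarrow>
      (y has_vector_derivative f (y t) (K (y (\<pi> k)))) (at t)"
      using AE_lebesgue_neq[of 0]
    proof eventually_elim
      case (elim t)
      show ?case
      proof
        assume t: "t \<in> {\<pi> k..\<pi> (Suc k)} \<inter> {0..<T1}"
        have "\<pi> k < \<pi> 1" using t by (auto simp: T1_def)
        then have "k = 0" using strict_mono_less[OF mono] by simp
        then show "(y has_vector_derivative f (y t) (K (y (\<pi> k)))) (at t)"
          using y(3) y(5)[of t] t elim T1(2) \<pi>0 by auto
      qed
    qed
  qed
  obtain T x where T: "0 < T" and x: "sampling_arc f C K \<pi> T x" "x 0 = z"
    and max: "\<not> (\<exists>T' y. T < T' \<and> sampling_arc f C K \<pi> T' y \<and> (\<forall>t\<in>time_dom T. y t = x t))"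
    using maximal_sampling_arc[OF nn _ arc1] T1(1) y(3) by (auto simp: zero_ereal_def)
  \<comment> \<open>The implication stands under the quantifier so that \<open>w\<close> is
    available for defining \<open>x'\<close> in either case; if the target is not approached, any
    value will do.\<close>
  have "\<exists>w. reaches_target C T x \<longrightarrow> w \<in> frontier C \<and> (\<exists>\<tau>::nat \<Rightarrow> real. strict_mono \<tau> \<and>
      (\<forall>i. \<tau> i \<in> time_dom T) \<and> (\<lambda>i. ereal (\<tau> i)) \<longlonglongrightarrow> T \<and> (\<lambda>i. x (\<tau> i)) \<longlonglongrightarrow> w)"
  proof (cases "reaches_target C T x")
    case True
    then obtain \<theta> where \<theta>: "T = ereal \<theta>" "0 < \<theta>"
      using T by (cases T) (auto simp: reaches_target_def)
    have lim: "((\<lambda>t. infdist (x t) C) \<longlongrightarrow> 0) (at_left \<theta>)" using True \<theta> by (simp add: reaches_target_def)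
    define t where "t n = \<theta> - \<theta> / (real n + 1)" for n
    have t_mono: "strict_mono t"
    proof (rule strict_monoI)
      fix m n :: nat assume "m < n"
      then have "\<theta> / (real n + 1) < \<theta> / (real m + 1)" using \<theta>(2) by (intro divide_strict_left_mono) auto
      then show "t m < t n" by (simp add: t_def)
    qed
    have t_dom: "t n \<in> time_dom T" for n
      using \<theta> by (auto simp: time_dom_def t_def divide_le_eq mult_le_cancel_left1)
    have "(\<lambda>n. 1 / (real n + 1)) \<longlonglongrightarrow> 0"
      using LIMSEQ_inverse_real_of_nat by (simp add: inverse_eq_divide add.commute)
    then have "(\<lambda>n. \<theta> - \<theta> * (1 / (real n + 1))) \<longlonglongrightarrow> \<theta> - \<theta> * 0" by (intro tendsto_intros)
    then have t_lim: "t \<longlonglongrightarrow> \<theta>" by (simp add: t_def[abs_def])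
    have "filterlim t (at_left \<theta>) sequentially"
      unfolding filterlim_at using t_lim \<theta> by (auto simp: t_def intro!: always_eventually)
    then have "(\<lambda>n. infdist (x (t n)) C) \<longlonglongrightarrow> 0" by (rule filterlim_compose[OF lim])
    moreover have "x (t n) \<notin> C" for n using x(1) t_dom by (simp add: sampling_arc_def)
    ultimately obtain r w where r: "strict_mono (r :: nat \<Rightarrow> nat)" "w \<in> frontier C"
        "((\<lambda>n. x (t n)) \<circ> r) \<longlonglongrightarrow> w"
      using frontier_cluster_point[OF C, of "\<lambda>n. x (t n)"] by blast
    have "strict_mono (t \<circ> r)" using t_mono r(1) by (rule strict_mono_o)
    moreover have "(\<lambda>i. ereal ((t \<circ> r) i)) \<longlonglongrightarrow> T"
      using LIMSEQ_subseq_LIMSEQ[OF t_lim r(1)] by (simp add: \<theta> o_def)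
    ultimately show ?thesis using r t_dom
      by (intro exI[of _ w] impI conjI exI[of _ "t \<circ> r"]) (auto simp: o_def)
  qed auto
  then obtain w where w: "reaches_target C T x \<Longrightarrow> w \<in> frontier C \<and> (\<exists>\<tau>::nat \<Rightarrow> real. strict_mono \<tau> \<and>
      (\<forall>i. \<tau> i \<in> time_dom T) \<and> (\<lambda>i. ereal (\<tau> i)) \<longlonglongrightarrow> T \<and> (\<lambda>i. x (\<tau> i)) \<longlonglongrightarrow> w)" by blast
  define x' where "x' t = (if T \<le> ereal t then w else x t)" for t
  have x': "x' t = x t" if "t \<in> time_dom T" for t using that by (auto simp: x'_def time_dom_def)
  have "0 \<in> time_dom T" using T by (simp add: time_dom_def zero_ereal_def)
  define u where "u t = K (x' (\<pi> (LEAST k. t < \<pi> (Suc k))))" for t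
  have "sampling_pair f C K \<pi> T x' u"
    unfolding sampling_pair_def
  proof (intro conjI)
    show "sampling_arc f C K \<pi> T x'" by (rule sampling_arc_cong[OF nn x(1)]) (simp add: x')
    show "\<not> (\<exists>T' y. T < T' \<and> sampling_arc f C K \<pi> T' y \<and> (\<forall>t\<in>time_dom T. y t = x' t))"
      using max by (simp add: x')
    show "T = sampling_end \<pi> T" using sampling_end_eq[OF \<pi> T] by simp
    show "\<forall>k. \<forall>t\<in>{\<pi> k..<\<pi> (Suc k)} \<inter> time_dom T. u t = K (x' (\<pi> k))"
    proof (intro allI ballI)
      fix k t assume t: "t \<in> {\<pi> k..<\<pi> (Suc k)} \<inter> time_dom T"
      have "(LEAST k. t < \<pi> (Suc k)) = k"
      proof (rule Least_equality)
        fix j assume "t < \<pi> (Suc j)"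
        then have "\<pi> k < \<pi> (Suc j)" using t by auto
        then show "k \<le> j" using strict_mono_less[OF mono] by auto
      qed (use t in auto)
      then show "u t = K (x' (\<pi> k))" by (simp add: u_def)
    qed
    show "reaches_target C T x' \<longrightarrow> extended_by_limit C T x'"
    proof
      assume re': "reaches_target C T x'"
      then obtain \<theta> where \<theta>: "T = ereal \<theta>" "0 < \<theta>"
        using T by (cases T) (auto simp: reaches_target_def)
      have "\<forall>\<^sub>F t in at_left \<theta>. infdist (x' t) C = infdist (x t) C"
        using eventually_at_left_real[of 0 \<theta>] \<theta> by (auto elim!: eventually_mono simp: x'_def)
      from tendsto_cong[OF this, of 0] have "reaches_target C T x"
        using re' by (simp add: reaches_target_def \<theta>)
      then obtain \<tau> :: "nat \<Rightarrow> real" where "w \<in> frontier C" "strict_mono \<tau>" "\<forall>i. \<tau> i \<in> time_dom T"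
          "(\<lambda>i. ereal (\<tau> i)) \<longlonglongrightarrow> T" "(\<lambda>i. x (\<tau> i)) \<longlonglongrightarrow> w"
        using w by blast
      moreover from this have "(\<lambda>i. x' (\<tau> i)) = (\<lambda>i. x (\<tau> i))" using x' by auto
      moreover have "\<forall>t. T \<le> ereal t \<longrightarrow> x' t = w" by (simp add: x'_def)
      ultimately show "extended_by_limit C T x'"
        unfolding extended_by_limit_def by metis
    qed
  qed (use T in auto)
  moreover have "x' 0 = z" using x'[OF \<open>0 \<in> time_dom T\<close>] x(2) by simp
  ultimately show ?thesis by blast
qed

section \<open>Infinite concatenation\<close>

lemma admissible_infdist_after:
  assumes "closed C" "admissible_pair f C U T x u" "T \<le> ereal t"
  shows "infdist (x t) C = 0"
proof -
  have "T < \<infinity>" using assms(3) by (cases T) auto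
  then have "x t \<in> frontier C"
    using assms(2,3) by (auto simp: admissible_pair_def extended_by_limit_def)
  then have "x t \<in> C" using assms(1) frontier_subset_closed by blast
  then show ?thesis by simp
qed

text \<open>On an infinite horizon every clause of admissibility is local in time, and each bounded
  time interval is covered by some pair. Controls agree only before \<open>s i\<close>, because a
  later piece may switch the control at that very time.\<close>

lemma admissible_limit:
  fixes s :: "nat \<Rightarrow> real"
  assumes adm: "\<And>i. admissible_pair f C U (T i) (X i) (V i)"
    and s: "filterlim s at_top sequentially" and sT: "\<And>i. ereal (s i) < T i"
    and x: "\<And>i t. 0 \<le> t \<Longrightarrow> t \<le> s i \<Longrightarrow> x t = X i t"
    and u: "\<And>i t. 0 \<le> t \<Longrightarrow> t < s i \<Longrightarrow> u t = V i t"
  shows "admissible_pair f C U \<infinity> x u"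
proof -
  have ev: "\<forall>\<^sub>F i in sequentially. b < s i" for b
    using s by (simp add: filterlim_at_top_dense)
  have ex: "\<exists>i. b < s i" for b
    using eventually_happens[OF ev[of b]] by simp
  have dom: "t \<in> time_dom (T i)" if "0 \<le> t" "t < s i" for i t
    using that sT[of i] by (auto simp: time_dom_def) (meson ereal_less_eq(3) less_imp_le order_le_less_trans)
  have inf: "t \<in> time_dom \<infinity> \<longleftrightarrow> 0 \<le> t" for t by (simp add: time_dom_def)
  have "Linf_loc \<infinity> U u"
    unfolding Linf_loc_def
  proof (intro conjI ballI allI impI)
    show "set_borel_measurable lebesgue (time_dom \<infinity>) u"
      unfolding set_borel_measurable_def
    \<comment> \<open>At each point the sequence is eventually constant, so \<open>u\<close> is a
      pointwise limit of measurable functions.\<close>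
    proof (rule borel_measurable_LIMSEQ_metric)
      show "(\<lambda>t. indicator (time_dom (T i)) t *\<^sub>R V i t) \<in> borel_measurable lebesgue" for i
        using adm[of i] by (simp add: admissible_pair_def Linf_loc_def set_borel_measurable_def)
      show "(\<lambda>i. indicator (time_dom (T i)) t *\<^sub>R V i t) \<longlonglongrightarrow> indicator (time_dom \<infinity>) t *\<^sub>R u t" for t
      proof (rule tendsto_eventually)
        show "\<forall>\<^sub>F i in sequentially. indicator (time_dom (T i)) t *\<^sub>R V i t = indicator (time_dom \<infinity>) t *\<^sub>R u t"
          using ev[of t]
        proof eventually_elim
          case (elim i)
          show ?case
          proof (cases "0 \<le> t")
            case True
            then show ?thesis using dom[OF True elim] u[OF True elim] by (simp add: inf)
          qed (simp add: time_dom_def)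
        qed
      qed
    qed
    show "u t \<in> U" if t: "t \<in> time_dom \<infinity>" for t
    proof -
      obtain i where "t < s i" using ex by blast
      then show ?thesis using t adm[of i] u[of t i] dom[of t i] by (simp add: inf admissible_pair_def Linf_loc_def)
    qed
    fix J :: "real set" assume J: "compact J \<and> J \<subseteq> time_dom \<infinity>"
    then obtain b where b: "\<And>t. t \<in> J \<Longrightarrow> t \<le> b"
      using compact_imp_bounded bounded_imp_bdd_above by (meson bdd_above.E)
    obtain i where i: "b < s i" using ex by blast
    have J': "0 \<le> t \<and> t < s i" if "t \<in> J" for t using b[OF that] i J that by (auto simp: inf)
    then have "J \<subseteq> time_dom (T i)" using dom by blast
    then obtain B where "AE t in lebesgue. t \<in> J \<longrightarrow> norm (V i t) \<le> B"
      using Linf_loc_bound[of "T i" U "V i" J] adm[of i] J by (auto simp: admissible_pair_def)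
    then have "AE t in lebesgue. t \<in> J \<longrightarrow> norm (u t) \<le> B"
    proof eventually_elim
      case (elim t)
      then show ?case using J'[of t] u[of t i] by auto
    qed
    then show "\<exists>B. AE t in lebesgue. t \<in> J \<longrightarrow> norm (u t) \<le> B" by blast
  qed
  moreover have "x t \<notin> C" if "t \<in> time_dom \<infinity>" for t
  proof -
    obtain i where "t < s i" using ex by blast
    then show ?thesis using that adm[of i] x[of t i] dom[of t i] by (simp add: inf admissible_pair_def)
  qed
  moreover have "loc_abs_continuous \<infinity> x"
  proof (rule loc_abs_continuous_local)
    fix b :: real assume "0 \<le> b"
    obtain i where i: "b < s i" using ex by blast
    have "ereal b < T i" using i sT[of i] by (meson ereal_less_eq(3) less_imp_le order_le_less_trans)
    moreover have "loc_abs_continuous (T i) (X i)" using adm[of i] by (simp add: admissible_pair_def)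
    moreover have "\<forall>t\<in>{0..b}. X i t = x t" using x[of _ i] i by simp
    ultimately show "\<exists>S y. ereal b < S \<and> loc_abs_continuous S y \<and> (\<forall>t\<in>{0..b}. y t = x t)" by blast
  qed
  moreover have "AE t in lebesgue. t \<in> time_dom \<infinity> \<longrightarrow> (x has_vector_derivative f (x t) (u t)) (at t)"
  proof (rule AE_time_dom)
    fix b :: real
    obtain i where i: "b < s i" using ex by blast
    have "AE t in lebesgue. t \<in> time_dom (T i) \<longrightarrow> (X i has_vector_derivative f (X i t) (V i t)) (at t)"
      using adm[of i] by (simp add: admissible_pair_def)
    then show "AE t in lebesgue. t \<in> {0<..<b} \<longrightarrow> (x has_vector_derivative f (x t) (u t)) (at t)"
    proof eventually_elim
      case (elim t)
      show ?case
      proof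
        assume t: "t \<in> {0<..<b}"
        then have "(X i has_vector_derivative f (X i t) (V i t)) (at t)" using elim dom[of t i] i by simp
        then have "(x has_vector_derivative f (X i t) (V i t)) (at t)"
          by (rule has_vector_derivative_cong_Ioo[OF _ t]) (use x[of _ i] i in simp)
        then show "(x has_vector_derivative f (x t) (u t)) (at t)" using x[of t i] u[of t i] t i by simp
      qed
    qed
  qed
  ultimately show ?thesis by (simp add: admissible_pair_def)
qed

text \<open>Dependent choice appends one stage at each switching time until the target is reached.
  The bound \<open>1 \<le> \<tau> n\<close> makes the switching times diverge, so that an endless
  construction covers all times, and since \<open>M\<close> decreases, a later piece also obeys the
  bounds of the earlier stages.\<close>

lemma admissible_chain:
  fixes f :: "'a::euclidean_space \<Rightarrow> 'b::euclidean_space \<Rightarrow> 'a" and r M \<tau> :: "nat \<Rightarrow> real"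
  assumes C: "closed C" and \<tau>: "\<And>n. 1 \<le> \<tau> n" and M: "decseq M" "\<And>n. 0 \<le> M n" and r: "\<And>n. 0 \<le> r n"
    and step: "\<And>n z. z \<notin> C \<Longrightarrow> infdist z C \<le> r n \<Longrightarrow> \<exists>T x u. admissible_pair f C U T x u \<and> x 0 = z \<and>
      (\<forall>t\<ge>0. infdist (x t) C \<le> M n) \<and> (\<forall>t\<ge>\<tau> n. infdist (x t) C \<le> r (Suc n))"
    and z: "z \<notin> C" "infdist z C \<le> r 0"
  shows "\<exists>T x u. admissible_pair f C U T x u \<and> x 0 = z \<and>
    (\<forall>n. \<forall>t\<ge>(\<Sum>i<n. \<tau> i). infdist (x t) C \<le> M n)"
proof -
  define \<sigma> where "\<sigma> n = (\<Sum>i<n. \<tau> i)" for n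
  have \<sigma>_Suc: "\<sigma> (Suc n) = \<sigma> n + \<tau> n" for n by (simp add: \<sigma>_def)
  have \<sigma>_ge: "real n \<le> \<sigma> n" for n
  proof (induction n)
    case (Suc n)
    then show ?case using \<tau>[of n] by (simp add: \<sigma>_Suc)
  qed (simp add: \<sigma>_def)
  have \<sigma>_mono: "mono \<sigma>" unfolding mono_iff_le_Suc using \<tau> by (auto simp: \<sigma>_Suc intro: order_trans[of 0 1])
  \<comment> \<open>Two kinds of bounds are carried along: the overshoot bounds of all stages so
    far, and the radius \<open>r (Suc n)\<close> that permits the next stage to start.\<close>
  define good :: "nat \<Rightarrow> ereal \<times> (real \<Rightarrow> 'a) \<times> (real \<Rightarrow> 'b) \<Rightarrow> bool" where
    "good n = (\<lambda>(T, x, u). admissible_pair f C U T x u \<and> x 0 = z \<and>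
      (\<forall>l\<le>n. \<forall>t\<ge>\<sigma> l. infdist (x t) C \<le> M l) \<and> (\<forall>t\<ge>\<sigma> (Suc n). infdist (x t) C \<le> r (Suc n)))" for n
  \<comment> \<open>The trajectory is kept up to and including the switching time, the control only
    before it, since the new piece determines the control from then on.\<close>
  define ext :: "nat \<Rightarrow> ereal \<times> (real \<Rightarrow> 'a) \<times> (real \<Rightarrow> 'b) \<Rightarrow> ereal \<times> (real \<Rightarrow> 'a) \<times> (real \<Rightarrow> 'b) \<Rightarrow> bool" where
    "ext n = (\<lambda>(T, x, u) (S, y, v). (\<forall>t\<le>\<sigma> (Suc n). y t = x t) \<and> (\<forall>t<\<sigma> (Suc n). v t = u t))" for n
  have "\<exists>p. \<forall>n. good n (p n) \<and> ext n (p n) (p (Suc n))"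
  proof (rule dependent_nat_choice)
    obtain T x u where "admissible_pair f C U T x u" "x 0 = z" "\<forall>t\<ge>0. infdist (x t) C \<le> M 0"
        "\<forall>t\<ge>\<tau> 0. infdist (x t) C \<le> r (Suc 0)"
      using step[OF z] by blast
    then have "good 0 (T, x, u)" by (simp add: good_def \<sigma>_def)
    then show "\<exists>p. good 0 p" by blast
  next
    fix p n assume p: "good n p"
    obtain T x u where eq: "p = (T, x, u)" by (metis surj_pair)
    let ?s = "\<sigma> (Suc n)"
    have adm: "admissible_pair f C U T x u" and x0: "x 0 = z"
      and xM: "\<And>l t. l \<le> n \<Longrightarrow> \<sigma> l \<le> t \<Longrightarrow> infdist (x t) C \<le> M l"
      and xr: "\<And>t. ?s \<le> t \<Longrightarrow> infdist (x t) C \<le> r (Suc n)"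
      using p by (auto simp: good_def eq)
    have s: "0 < ?s" using \<sigma>_ge[of "Suc n"] by simp
    show "\<exists>q. good (Suc n) q \<and> ext n p q"
    proof (cases "T \<le> ereal ?s")
      \<comment> \<open>The target has been reached by the switching time. The distance is zero from
        then on, so the pair is kept as it stands.\<close>
      case True
      have zero: "infdist (x t) C = 0" if "?s \<le> t" for t
        using admissible_infdist_after[OF C adm order_trans[OF True]] that by simp
      have "good (Suc n) p"
        using adm x0 xM zero M(2) r monoD[OF \<sigma>_mono, of "Suc n" "Suc (Suc n)"]
        by (auto simp: good_def eq le_Suc_eq)
      then show ?thesis by (intro exI[of _ p]) (auto simp: ext_def eq)
    next
      case False
      then have sT: "ereal ?s < T" by simp
      then have "x ?s \<notin> C" using adm s by (simp add: admissible_pair_def time_dom_def)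
      then obtain S y v where y: "admissible_pair f C U S y v" "y 0 = x ?s"
          "\<And>t. 0 \<le> t \<Longrightarrow> infdist (y t) C \<le> M (Suc n)"
          "\<And>t. \<tau> (Suc n) \<le> t \<Longrightarrow> infdist (y t) C \<le> r (Suc (Suc n))"
        using step[of "x ?s" "Suc n"] xr[of ?s] by blast
      define x' where "x' t = (if t < ?s then x t else y (t - ?s))" for t
      define u' where "u' t = (if t < ?s then u t else v (t - ?s))" for t
      have "admissible_pair f C U (ereal ?s + S) x' u'"
        unfolding x'_def[abs_def] u'_def[abs_def] by (rule admissible_concat[OF adm y(1) s sT y(2)])
      moreover have "x' 0 = z" using s x0 by (simp add: x'_def)
      moreover have "infdist (x' t) C \<le> M l" if "l \<le> Suc n" "\<sigma> l \<le> t" for l t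
      proof (cases "t < ?s")
        case True
        then have "l \<le> n" using that by (cases "l = Suc n") auto
        then show ?thesis using True xM that by (simp add: x'_def)
      next
        case False
        then have "infdist (x' t) C \<le> M (Suc n)" using y(3) by (simp add: x'_def)
        also have "\<dots> \<le> M l" using M(1) that(1) by (rule decseqD)
        finally show ?thesis .
      qed
      moreover have "infdist (x' t) C \<le> r (Suc (Suc n))" if "\<sigma> (Suc (Suc n)) \<le> t" for t
      proof -
        have "\<not> t < ?s" "\<tau> (Suc n) \<le> t - ?s" using that \<sigma>_Suc[of "Suc n"] \<tau>[of "Suc n"] by linarith+
        then show ?thesis using y(4) by (simp add: x'_def)
      qed
      ultimately have "good (Suc n) (ereal ?s + S, x', u')" by (simp add: good_def)
      moreover have "ext n p (ereal ?s + S, x', u')"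
        using y(2) by (auto simp: ext_def eq x'_def u'_def)
      ultimately show ?thesis by blast
    qed
  qed
  then obtain p where good: "\<And>n. good n (p n)" and ext: "\<And>n. ext n (p n) (p (Suc n))" by blast
  define T where "T n = fst (p n)" for n
  define X where "X n = fst (snd (p n))" for n
  define V where "V n = snd (snd (p n))" for n
  have peq: "p n = (T n, X n, V n)" for n by (simp add: T_def X_def V_def)
  have adm: "admissible_pair f C U (T n) (X n) (V n)" and X0: "X n 0 = z"
    and XM: "\<And>l t. l \<le> n \<Longrightarrow> \<sigma> l \<le> t \<Longrightarrow> infdist (X n t) C \<le> M l" for n
    using good[of n] by (auto simp: good_def peq)
  show ?thesis
  \<comment> \<open>A pair that ends by its switching time meets all later bounds with distance
    zero. Otherwise every pair outlives its switching time, and the limit is defined for all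
    times.\<close>
  proof (cases "\<exists>n. T n \<le> ereal (\<sigma> (Suc n))")
    case True
    then obtain n where n: "T n \<le> ereal (\<sigma> (Suc n))" by blast
    have "infdist (X n t) C \<le> M l" if "\<sigma> l \<le> t" for l t
    proof (cases "l \<le> n")
      case False
      then have "\<sigma> (Suc n) \<le> t" using monoD[OF \<sigma>_mono, of "Suc n" l] that by simp
      then have "T n \<le> ereal t" using n by (meson ereal_less_eq(3) order_trans)
      then show ?thesis using admissible_infdist_after[OF C adm] M(2) by simp
    qed (use XM that in auto)
    then show ?thesis
      using adm[of n] X0[of n] unfolding \<sigma>_def by (intro exI[of _ "T n"] exI[of _ "X n"] exI[of _ "V n"]) simp
  next
    case False
    have step_eq: "X (Suc n) t = X n t" if "t \<le> \<sigma> (Suc n)" for n t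
      using ext[of n] that by (simp add: ext_def peq)
    have step_eq': "V (Suc n) t = V n t" if "t < \<sigma> (Suc n)" for n t
      using ext[of n] that by (simp add: ext_def peq)
    have XX: "X m t = X n t" if "n \<le> m" "t \<le> \<sigma> (Suc n)" for n m t
      using that(1)
    proof (induction m rule: dec_induct)
      case (step m)
      have "t \<le> \<sigma> (Suc m)" using that(2) monoD[OF \<sigma>_mono, of "Suc n" "Suc m"] step by simp
      then show ?case using step step_eq by simp
    qed simp
    have VV: "V m t = V n t" if "n \<le> m" "t < \<sigma> (Suc n)" for n m t
      using that(1)
    proof (induction m rule: dec_induct)
      case (step m)
      have "t < \<sigma> (Suc m)" using that(2) monoD[OF \<sigma>_mono, of "Suc n" "Suc m"] step by simp
      then show ?case using step step_eq' by simp
    qed simp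
    define N where "N t = (LEAST n. t < \<sigma> (Suc n))" for t
    define x where "x t = X (N t) t" for t
    define u where "u t = V (N t) t" for t
    have N: "t < \<sigma> (Suc (N t))" for t
    proof -
      obtain n where "t < real n" using reals_Archimedean2 by blast
      then have "t < \<sigma> (Suc n)" using \<sigma>_ge[of "Suc n"] by simp
      then show ?thesis unfolding N_def by (rule LeastI)
    qed
    have x: "x t = X n t" if "t \<le> \<sigma> (Suc n)" for n t
      using XX[of n "N t" t] XX[of "N t" n t] that N[of t] unfolding x_def by (cases "n \<le> N t") auto
    have u: "u t = V n t" if "t < \<sigma> (Suc n)" for n t
      using VV[of n "N t" t] VV[of "N t" n t] that N[of t] unfolding u_def by (cases "n \<le> N t") auto
    have "filterlim (\<lambda>n. \<sigma> (Suc n)) at_top sequentially"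
    proof (rule filterlim_at_top_mono[OF filterlim_real_sequentially])
      show "\<forall>\<^sub>F n in sequentially. real n \<le> \<sigma> (Suc n)"
      proof (intro always_eventually allI)
        show "real n \<le> \<sigma> (Suc n)" for n using \<sigma>_ge[of "Suc n"] by simp
      qed
    qed
    moreover have "ereal (\<sigma> (Suc n)) < T n" for n using False by (simp add: not_le)
    ultimately have "admissible_pair f C U \<infinity> x u"
      using x u by (intro admissible_limit[OF adm]) auto
    moreover have "x 0 = z" unfolding x_def by (rule X0)
    moreover have "infdist (x t) C \<le> M l" if "\<sigma> l \<le> t" for l t
    proof -
      have "t \<le> \<sigma> (Suc (max l (N t)))"
        using N[of t] monoD[OF \<sigma>_mono, of "Suc (N t)" "Suc (max l (N t))"] by simp
      then show ?thesis using x[of t "max l (N t)"] XM[of l "max l (N t)" t] that by simp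
    qed
    ultimately show ?thesis
      unfolding \<sigma>_def by (intro exI[of _ \<infinity>] exI[of _ x] exI[of _ u]) simp
  qed
qed

section \<open>Controllability\<close>

text \<open>Monotonicity of \<open>\<beta>\<close> in the first argument replaces
  \<open>infdist z C\<close> by \<open>R\<close>, so the waiting time for
  \<open>\<beta> R t < R / 2\<close> depends on \<open>R\<close> alone. It is raised to at least 1
  so that infinitely many stages cannot accumulate in finite time.\<close>

lemma sample_stabilizing_segment:
  fixes f :: "'a::euclidean_space \<Rightarrow> 'b::euclidean_space \<Rightarrow> 'a"
  assumes C: "closed C" "C \<noteq> {}" "compact (frontier C)"
    and f: "continuous_on ((- C) \<times> U) (\<lambda>(x, u). f x u)"
    and K: "feedback C U K" and \<beta>: "KL \<beta>"
    and stab: "\<And>r R. 0 < r \<Longrightarrow> r < R \<Longrightarrow>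
      \<exists>\<delta>>0. \<forall>\<pi> z. time_partition \<pi> \<and> partition_diam \<pi> \<le> ereal \<delta> \<and> z \<notin> C \<and> infdist z C \<le> R \<longrightarrow>
        (\<forall>T x u. sampling_pair f C K \<pi> T x u \<and> x 0 = z \<longrightarrow> admissible_pair f C U T x u \<and>
          (\<forall>t\<ge>0. infdist (x t) C \<le> max (\<beta> (infdist z C) t) r))"
    and R: "0 < R"
  shows "\<exists>\<tau>\<ge>1. \<forall>z. z \<notin> C \<and> infdist z C \<le> R \<longrightarrow> (\<exists>T x u. admissible_pair f C U T x u \<and> x 0 = z \<and>
    (\<forall>t\<ge>0. infdist (x t) C \<le> \<beta> R 0 + R) \<and> (\<forall>t\<ge>\<tau>. infdist (x t) C \<le> R / 2))"
proof -
  obtain \<delta> where \<delta>: "0 < \<delta>" "\<And>\<pi> z T x u. time_partition \<pi> \<Longrightarrow> partition_diam \<pi> \<le> ereal \<delta> \<Longrightarrow> z \<notin> C \<Longrightarrow>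
      infdist z C \<le> R \<Longrightarrow> sampling_pair f C K \<pi> T x u \<Longrightarrow> x 0 = z \<Longrightarrow> admissible_pair f C U T x u \<and>
        (\<forall>t\<ge>0. infdist (x t) C \<le> max (\<beta> (infdist z C) t) (R / 2))"
    using stab[of "R / 2" R] R by auto
  define \<pi> where "\<pi> k = real k * \<delta>" for k
  have "filterlim (\<lambda>k. real k * \<delta>) at_top sequentially"
    using filterlim_at_top_mult_tendsto_pos[OF tendsto_const \<delta>(1) filterlim_real_sequentially] .
  then have \<pi>: "time_partition \<pi>"
    using \<delta>(1) by (simp add: time_partition_def \<pi>_def[abs_def])
  have diam: "partition_diam \<pi> \<le> ereal \<delta>"
    by (simp add: partition_diam_def \<pi>_def algebra_simps)
  have "\<forall>\<^sub>F t in at_top. \<beta> R t < R / 2"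
    using order_tendstoD(2)[OF KL_props(5)[OF \<beta>, of R], of "R / 2"] R by simp
  then obtain \<tau>0 where \<tau>0: "\<And>t. \<tau>0 \<le> t \<Longrightarrow> \<beta> R t < R / 2" by (auto simp: eventually_at_top_linorder)
  show ?thesis
  proof (intro exI[of _ "max 1 \<tau>0"] conjI allI impI)
    fix z assume z: "z \<notin> C \<and> infdist z C \<le> R"
    obtain T x u where x: "sampling_pair f C K \<pi> T x u" "x 0 = z"
      using sampling_pair_exists[OF C f _ _ \<pi>, of K z] K z by (auto simp: feedback_def)
    then have adm: "admissible_pair f C U T x u"
      and bd: "\<And>t. 0 \<le> t \<Longrightarrow> infdist (x t) C \<le> max (\<beta> (infdist z C) t) (R / 2)"
      using \<delta>(2)[OF \<pi> diam _ _ x] z by auto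
    have bd': "infdist (x t) C \<le> max (\<beta> R t) (R / 2)" if "0 \<le> t" for t
    proof -
      have "\<beta> (infdist z C) t \<le> \<beta> R t"
        using KL_props(3)[OF \<beta>, of "infdist z C" R t] z that infdist_nonneg by auto
      then show ?thesis using bd[OF that] by linarith
    qed
    have "infdist (x t) C \<le> \<beta> R 0 + R" if "0 \<le> t" for t
      using bd'[OF that] KL_props(4)[OF \<beta>, of R 0 t] KL_props(1)[OF \<beta>, of R 0] R that by auto
    moreover have "infdist (x t) C \<le> R / 2" if "max 1 \<tau>0 \<le> t" for t
      using bd'[of t] \<tau>0[of t] that by auto
    ultimately show "\<exists>T x u. admissible_pair f C U T x u \<and> x 0 = z \<and>
      (\<forall>t\<ge>0. infdist (x t) C \<le> \<beta> R 0 + R) \<and> (\<forall>t\<ge>max 1 \<tau>0. infdist (x t) C \<le> R / 2)"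
      using adm x(2) by blast
  qed auto
qed

lemma sample_stabilizable_imp_GAC:
  fixes f :: "'a::euclidean_space \<Rightarrow> 'b::euclidean_space \<Rightarrow> 'a"
  assumes C: "closed C" "C \<noteq> {}" "compact (frontier C)"
    and f: "continuous_on ((- C) \<times> U) (\<lambda>(x, u). f x u)"
    and stab: "sample_stabilizable f C U"
  shows "GAC f C U"
proof -
  obtain K \<beta> where K: "feedback C U K" and \<beta>: "KL \<beta>"
    and st: "\<And>r R. 0 < r \<Longrightarrow> r < R \<Longrightarrow>
      \<exists>\<delta>>0. \<forall>\<pi> z. time_partition \<pi> \<and> partition_diam \<pi> \<le> ereal \<delta> \<and> z \<notin> C \<and> infdist z C \<le> R \<longrightarrow>
        (\<forall>T x u. sampling_pair f C K \<pi> T x u \<and> x 0 = z \<longrightarrow> admissible_pair f C U T x u \<and>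
          (\<forall>t\<ge>0. infdist (x t) C \<le> max (\<beta> (infdist z C) t) r))"
    using stab unfolding sample_stabilizable_def sample_stabilizes_def by blast
  \<comment> \<open>The summand \<open>R\<close> absorbs the tolerance \<open>R / 2\<close> of the
    sampling bound, while \<open>M\<close> remains continuous, increasing and zero at zero.\<close>
  define M where "M R = \<beta> R 0 + R" for R
  have M_mono: "M r \<le> M s" if "0 \<le> r" "r \<le> s" for r s
    using KL_props(3)[OF \<beta>, of r s 0] that by (simp add: M_def)
  have M0: "M 0 = 0" using KL_props(2)[OF \<beta>, of 0] by (simp add: M_def)
  have M_nonneg: "0 \<le> M r" if "0 \<le> r" for r using M_mono[of 0 r] M0 that by simp
  have M_cont: "continuous_on {0..} M"
    unfolding M_def[abs_def] by (intro continuous_intros KL_props(6)[OF \<beta>])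
  define lev where "lev j = 2 powr real_of_int j" for j
  have lev_pos: "0 < lev j" for j by (simp add: lev_def)
  have lev_half: "lev (j - 1) = lev j / 2" for j by (simp add: lev_def powr_diff)
  have lev_mono: "lev i \<le> lev j" if "i \<le> j" for i j using that by (simp add: lev_def)
  have "\<exists>\<tau>\<ge>1. \<forall>z. z \<notin> C \<and> infdist z C \<le> lev j \<longrightarrow> (\<exists>T x u. admissible_pair f C U T x u \<and> x 0 = z \<and>
    (\<forall>t\<ge>0. infdist (x t) C \<le> M (lev j)) \<and> (\<forall>t\<ge>\<tau>. infdist (x t) C \<le> lev (j - 1)))" for j
    using sample_stabilizing_segment[OF C f K \<beta> st lev_pos[of j]] unfolding M_def lev_half .
  then obtain \<tau> where \<tau>1: "\<And>j. 1 \<le> \<tau> j"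
    and seg: "\<And>j z. z \<notin> C \<Longrightarrow> infdist z C \<le> lev j \<Longrightarrow> \<exists>T x u. admissible_pair f C U T x u \<and> x 0 = z \<and>
      (\<forall>t\<ge>0. infdist (x t) C \<le> M (lev j)) \<and> (\<forall>t\<ge>\<tau> j. infdist (x t) C \<le> lev (j - 1))"
    by metis
  \<comment> \<open>For positive \<open>d\<close> this is the lowest level not below
    \<open>d\<close>.\<close>
  define J where "J d = \<lceil>log 2 d\<rceil>" for d :: real
  have J: "d \<le> lev (J d)" "lev (J d) \<le> 2 * d" if "0 < d" for d
  proof -
    have "d = 2 powr log 2 d" using that by simp
    also have "\<dots> \<le> lev (J d)" unfolding lev_def J_def by (intro powr_mono) auto
    finally show "d \<le> lev (J d)" .
    have "lev (J d) \<le> 2 powr (log 2 d + 1)" unfolding lev_def J_def by (intro powr_mono) linarith+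
    also have "\<dots> = 2 * d" using that by (simp add: powr_add)
    finally show "lev (J d) \<le> 2 * d" .
  qed
  have dist_pos: "0 < infdist z C" if "z \<notin> C" for z
    using in_closed_iff_infdist_zero[OF C(1,2), of z] infdist_nonneg[of z C] that by linarith
  have "\<exists>T x u. admissible_pair f C U T x u \<and> x 0 = z \<and>
      (\<forall>n. \<forall>t\<ge>(\<Sum>i<n. \<tau> (J (infdist z C) - int i)). infdist (x t) C \<le> M (lev (J (infdist z C) - int n)))"
    if z: "z \<notin> C" for z
  proof (rule admissible_chain[OF C(1), where r = "\<lambda>n. lev (J (infdist z C) - int n)"])
    show "decseq (\<lambda>n. M (lev (J (infdist z C) - int n)))"
      unfolding decseq_def by (auto intro!: M_mono lev_mono less_imp_le[OF lev_pos])
    fix n y assume "y \<notin> C" "infdist y C \<le> lev (J (infdist z C) - int n)"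
    from seg[OF this] show "\<exists>T x u. admissible_pair f C U T x u \<and> x 0 = y \<and>
      (\<forall>t\<ge>0. infdist (x t) C \<le> M (lev (J (infdist z C) - int n))) \<and>
      (\<forall>t\<ge>\<tau> (J (infdist z C) - int n). infdist (x t) C \<le> lev (J (infdist z C) - int (Suc n)))"
      by (simp add: algebra_simps)
  qed (use \<tau>1 z J(1)[OF dist_pos[OF z]] in \<open>auto intro!: M_nonneg less_imp_le[OF lev_pos]\<close>)
  then obtain T X V where adm: "\<And>z. z \<notin> C \<Longrightarrow> admissible_pair f C U (T z) (X z) (V z)"
    and X0: "\<And>z. z \<notin> C \<Longrightarrow> X z 0 = z"
    and bd: "\<And>z n t. z \<notin> C \<Longrightarrow> (\<Sum>i<n. \<tau> (J (infdist z C) - int i)) \<le> t \<Longrightarrow>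
      infdist (X z t) C \<le> M (lev (J (infdist z C) - int n))"
    by metis
  have "\<exists>\<gamma>. KL \<gamma> \<and> (\<forall>z\<in>- C. \<forall>t\<ge>0. infdist (X z t) C \<le> \<gamma> (infdist z C) t)"
  proof (rule KL_bound[where M = "\<lambda>r. M (2 * r)"])
    show "continuous_on {0..} (\<lambda>r. M (2 * r))"
      by (rule continuous_on_compose2[OF M_cont]) (auto intro!: continuous_intros)
    show "mono_on {0..} (\<lambda>r. M (2 * r))" by (auto simp: monotone_on_def intro: M_mono)
    show "M (2 * 0) = 0" by (simp add: M0)
    fix z and t :: real assume z: "z \<in> - C" and t: "0 \<le> t"
    have "infdist (X z t) C \<le> M (lev (J (infdist z C)))" using bd[of z 0 t] z t by simp
    also have "\<dots> \<le> M (2 * infdist z C)"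
      using J(2)[OF dist_pos, of z] z by (intro M_mono less_imp_le[OF lev_pos]) auto
    finally show "0 \<le> infdist (X z t) C \<and> infdist (X z t) C \<le> M (2 * infdist z C)"
      using infdist_nonneg by blast
  next
    fix N e :: real assume e: "0 < e"
    have "(M \<longlongrightarrow> 0) (at 0 within {0..})"
      using M_cont M0 by (metis atLeast_iff continuous_on_def order_refl)
    then have "\<forall>\<^sub>F r in at 0 within {0..}. M r < e" by (rule order_tendstoD(2)) (rule e)
    then obtain \<eta> where \<eta>: "0 < \<eta>" "\<And>r. 0 < r \<Longrightarrow> r < \<eta> \<Longrightarrow> M r < e"
      unfolding eventually_at by (auto simp: dist_real_def)
    obtain k where k: "M (lev k) < e"
    proof (rule that)
      \<comment> \<open>Rounding up at most doubles \<open>\<eta> / 4\<close>, which leaves the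
        level strictly below \<open>\<eta>\<close>.\<close>
      have "lev (J (\<eta> / 4)) \<le> 2 * (\<eta> / 4)" using \<eta>(1) by (intro J) simp
      then show "M (lev (J (\<eta> / 4))) < e" using \<eta> lev_pos by (intro \<eta>(2)) auto
    qed
    show "\<exists>S. \<forall>z\<in>- C. infdist z C \<le> N \<longrightarrow> (\<forall>t\<ge>S. 0 \<le> t \<longrightarrow> infdist (X z t) C \<le> e)"
    \<comment> \<open>This is the total duration of the stages from level \<open>J N\<close> down to
      level \<open>k\<close>. If \<open>J N < k\<close> the sum is empty, and every start considered
      falls under the first case below.\<close>
    proof (intro exI[of _ "\<Sum>m\<in>{k..J N}. \<tau> m"] ballI impI allI)
      fix z t assume z: "z \<in> - C" "infdist z C \<le> N" and t: "(\<Sum>m\<in>{k..J N}. \<tau> m) \<le> t" "0 \<le> t"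
      let ?j = "J (infdist z C)"
      have d: "0 < infdist z C" using z dist_pos by simp
      have jN: "?j \<le> J N" unfolding J_def using d z(2) by (intro ceiling_mono) simp
      show "infdist (X z t) C \<le> e"
      proof (cases "?j \<le> k")
        \<comment> \<open>The start is already at or below level \<open>k\<close>, so the overshoot
          bound of the first stage suffices at all times.\<close>
        case True
        have "infdist (X z t) C \<le> M (lev ?j)" using bd[of z 0 t] z t by simp
        also have "\<dots> \<le> M (lev k)" using True by (intro M_mono lev_mono less_imp_le[OF lev_pos])
        finally show ?thesis using k by simp
      next
        case False
        define n where "n = nat (?j - k)"
        have n: "?j - int n = k" using False by (simp add: n_def)
        \<comment> \<open>The first \<open>n\<close> stages run through the levels from
          \<open>?j\<close> down to \<open>k + 1\<close>. These are distinct indices of the larger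
          sum, whose terms are all nonnegative.\<close>
        have "(\<Sum>i<n. \<tau> (?j - int i)) = sum \<tau> ((\<lambda>i. ?j - int i) ` {..<n})"
          by (subst sum.reindex) (auto simp: inj_on_def)
        also have "\<dots> \<le> (\<Sum>m\<in>{k..J N}. \<tau> m)"
          using jN n by (intro sum_mono2) (auto intro: order_trans[OF zero_le_one \<tau>1])
        finally have "infdist (X z t) C \<le> M (lev (?j - int n))" using bd[of z n t] z t by simp
        then show ?thesis using k n by simp
      qed
    qed
  qed (auto intro: infdist_nonneg)
  then show ?thesis using adm X0 unfolding GAC_def by (metis Compl_iff)
qed

theorem theorem2p9:
  fixes f :: "real ^ 'n \<Rightarrow> real ^ 'm \<Rightarrow> real ^ 'n"
    and C :: "(real ^ 'n) set"
    and U :: "(real ^ 'm) set"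
  assumes "C \<noteq> {}" and "closed C" and "compact (frontier C)"
    and "closed U" and "cone U"
    and "continuous_on ((- C) \<times> U) (\<lambda>(x, u). f x u)"
    and "sample_stabilizable f C U"
  shows "GAC f C U"
  using assms by (intro sample_stabilizable_imp_GAC)

end
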